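(* Assume the setting and hypotheses (H(A)), (H(J)), (H($\iota$)), (H(f)), (H(0)) described in the context. For $N\in\mathbb N$ let $\tau=T/N$ and let $u_\tau^0\in V$ be given. Then there exists $\tau_0>0$ such that for all $0<\tau<\tau_0$, Problem $\mathcal P_\tau$ has a solution, i.e. there exist $\{u_\tau^n\}_{n=1}^N\subset V$ and $\{\xi_\tau^n\}_{n=1}^N\subset U^*$ such that $$\tfrac1\tau(u_\tau^1-u_\tau^0)+Au_\tau^1+\iota^*\xi_\tau^1=f_\tau^1,\qquad \xi_\tau^1\in\partial J(\iota u_\tau^1),$$ and for $n=2,\dots,N$, $$\tfrac1\tau\Big(\tfrac32u_\tau^n-2u_\tau^{n-1}+\tfrac12u_\tau^{n-2}\Big)+Au_\tau^n+\iota^*\xi_\tau^n=f_\tau^n,\qquad \xi_\tau^n\in\partial J(\iota u_\tau^n),$$ where $f_\tau^1=\frac1\tau\int_0^\tau f(t)\,dt$ and $f_\tau^n=\frac{3}{2\tau}\int_{(n-1)\tau}^{n\tau}f(t)\,dt-\frac{1}{2\tau}\int_{(n-2)\tau}^{(n-1)\tau}f(t)\,dt$ for $n=2,\dots,N$.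
   Context: $V$ is a real reflexive separable Banach space with norm $\|\cdot\|$, $H$ is a real separable Hilbert space with inner product $(\cdot,\cdot)$ and norm $|\cdot|$, identified with its dual, and $V\subset H\subset V^*$ with dense continuous embeddings, the embedding $V\subset H$ being compact; $\langle\cdot,\cdot\rangle$ is the duality pairing of $V^*$ and $V$, with $\langle u,v\rangle=(u,v)$ for $u\in H$, $v\in V$. $U$ is a reflexive Banach space, $T>0$. For a locally Lipschitz $J\colon U\to\mathbb R$, the Clarke generalized directional derivative is $J^0(x;v)=\limsup_{y\to x,\lambda\downarrow0}\frac{J(y+\lambda v)-J(y)}{\lambda}$ and the Clarke subdifferential is $\partial J(x)=\{\xi\in U^*:J^0(x;v)\ge\langle\xi,v\rangle_{U^*\times U}\ \forall v\in U\}$. $\iota^*\colon U^*\to V^*$ denotes the adjoint of $\iota$. Hypotheses: (H(A)) $A\colon V\to V^*$ is pseudomonotone (i.e. whenever $v_n\to v$ weakly in $V$ and $\limsup_n\langle Av_n,v_n-v\rangle\le0$, then $\langle Av,v-y\rangle\le\liminf_n\langle Av_n,v_n-y\rangle$ for every $y\in V$), $\|Av\|_{V^*}\le a+b\|v\|$ for all $v\in V$ with $a\ge0$, $b>0$, and $\langle Av,v\rangle\ge\alpha\|v\|^2-\beta|v|^2$ for all $v\in V$ with $\alpha>0$, $\beta\ge0$. (H(J)) $J\colon U\to\mathbb R$ is locally Lipschitz and $\|\xi\|_{U^*}\le d(1+\|u\|_U)$ for all $u\in U$, $\xi\in\partial J(u)$, with $d>0$. (H($\iota$)) $\iota\colon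 V\to U$ is linear, continuous and compact, and there is a Banach space $Z$ with $V\subset Z\subset H$, $V\subset Z$ compact, $Z\subset H$ continuous, such that $\iota=\iota_2\circ\iota_1$ with $\iota_1\colon V\to Z$ the identity and $\iota_2\colon Z\to U$ linear continuous. (H(f)) $f\in L^2(0,T;V^* )$. (H(0)) $u_0\in H$. *)

theory Defs
  imports "HOL-Analysis.Analysis"
begin

text \<open>Dual of a real normed space X is modelled as the type of bounded linear functionals
  X \<Rightarrow>L real; the duality pairing is application.\<close>

definition reflexive_space :: "'a::real_normed_vector itself \<Rightarrow> bool" where
  "reflexive_space _ \<longleftrightarrow>
     (\<forall>\<phi> :: ('a \<Rightarrow>\<^sub>L real) \<Rightarrow>\<^sub>L real. \<exists>x::'a. \<forall>g. blinfun_apply \<phi> g = blinfun_apply g x)"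

definition weakly_convergent :: "(nat \<Rightarrow> 'a::real_normed_vector) \<Rightarrow> 'a \<Rightarrow> bool" where
  "weakly_convergent vs v \<longleftrightarrow>
     (\<forall>g :: 'a \<Rightarrow>\<^sub>L real. (\<lambda>n. blinfun_apply g (vs n)) \<longlonglongrightarrow> blinfun_apply g v)"

definition pseudomonotone :: "('a::real_normed_vector \<Rightarrow> ('a \<Rightarrow>\<^sub>L real)) \<Rightarrow> bool" where
  "pseudomonotone A \<longleftrightarrow>
     (\<forall>vs v. weakly_convergent vs v \<and>
             limsup (\<lambda>n. ereal (blinfun_apply (A (vs n)) (vs n - v))) \<le> 0 \<longrightarrow>
             (\<forall>y. ereal (blinfun_apply (A v) (v - y))
                   \<le> liminf (\<lambda>n. ereal (blinfun_apply (A (vs n)) (vs n - y)))))"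

definition compact_map :: "('a::real_normed_vector \<Rightarrow> 'b::real_normed_vector) \<Rightarrow> bool" where
  "compact_map K \<longleftrightarrow> (\<forall>B. bounded B \<longrightarrow> compact (closure (K ` B)))"

definition locally_lipschitz :: "('a::metric_space \<Rightarrow> real) \<Rightarrow> bool" where
  "locally_lipschitz J \<longleftrightarrow> (\<forall>x. \<exists>r>0. \<exists>L. L-lipschitz_on (ball x r) J)"

definition clarke_dd :: "('a::real_normed_vector \<Rightarrow> real) \<Rightarrow> 'a \<Rightarrow> 'a \<Rightarrow> ereal" where
  "clarke_dd J x v =
     Limsup (at (x, 0) within (UNIV \<times> {0<..}))
            (\<lambda>(y, l). ereal ((J (y + l *\<^sub>R v) - J y) / l))"

definition clarke_subdiff :: "('a::real_normed_vector \<Rightarrow> real) \<Rightarrow> 'a \<Rightarrow> ('a \<Rightarrow>\<^sub>L real) set" where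
  "clarke_subdiff J x = {\<xi>. \<forall>v. ereal (blinfun_apply \<xi> v) \<le> clarke_dd J x v}"

definition strongly_measurable_on :: "real set \<Rightarrow> (real \<Rightarrow> 'b::real_normed_vector) \<Rightarrow> bool" where
  "strongly_measurable_on S f \<longleftrightarrow>
     (\<exists>s :: nat \<Rightarrow> real \<Rightarrow> 'b.
        (\<forall>n. finite (range (s n)) \<and> (\<forall>c. s n -` {c} \<in> sets lebesgue)) \<and>
        (AE t in lebesgue. t \<in> S \<longrightarrow> (\<lambda>n. s n t) \<longlonglongrightarrow> f t))"

definition L2_on :: "real \<Rightarrow> real \<Rightarrow> (real \<Rightarrow> 'b::real_normed_vector) \<Rightarrow> bool" where
  "L2_on a b f \<longleftrightarrow>
     strongly_measurable_on {a..b} f \<and> integrable (lebesgue_on {a..b}) (\<lambda>t. (norm (f t))\<^sup>2)"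

end

theory Submission
  imports Defs
begin

text \<open>Each time step asks for \<open>u\<close> and \<open>\<xi> \<in> \<partial>J(\<iota> u)\<close> with \<open>c i\<^sup>* i u + A u + \<iota>\<^sup>* \<xi> = g\<close>, where
  \<open>c = 1/\<tau>\<close> or \<open>c = 3/(2\<tau>)\<close>. Ehrling's inequality absorbs \<open>\<xi>\<close> into \<open>A\<close> and \<open>c\<close>, so the problem is coercive
  once \<open>c\<close> is large, which fixes \<open>\<tau>\<^sub>0\<close>. It is solved by a Galerkin method: on the span of finitely many
  vectors the subdifferential is replaced by a continuous approximate selection, and Kuhn's
  combinatorial lemma gives a solution of a variational inequality on a large cube of coefficients,
  which by coercivity is a zero. In the limit, weak convergence in \<open>V\<close> is strong in \<open>H\<close> and in \<open>U\<close>;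
  pseudomonotonicity then identifies the limit of \<open>A u\<^sub>n\<close>, and a Hahn-Banach cluster point of the
  approximate subgradients lies in \<open>\<partial>J(\<iota> u)\<close> by upper semicontinuity of the Clarke derivative.\<close>

section \<open>Sublinear functionals\<close>

definition sublinear :: "('a::real_vector \<Rightarrow> real) \<Rightarrow> bool" where
  "sublinear p \<longleftrightarrow> (\<forall>x y. p (x + y) \<le> p x + p y) \<and> (\<forall>t x. 0 \<le> t \<longrightarrow> p (t *\<^sub>R x) = t * p x)"

text \<open>Scaling back by \<open>inverse t\<close> turns the one-sided homogeneity bound into an
  equality, so functionals defined as infima need only the inequality.\<close>

lemma sublinearI:
  assumes "\<And>x y. p (x + y) \<le> p x + p y" and "\<And>t x. 0 < t \<Longrightarrow> p (t *\<^sub>R x) \<le> t * p x" and "p 0 = 0"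
  shows "sublinear p"
proof -
  have "p (t *\<^sub>R x) = t * p x" if "0 \<le> t" for t x
  proof (cases "t = 0")
    case False
    then have t: "0 < t" using that by simp
    have "p (inverse t *\<^sub>R (t *\<^sub>R x)) \<le> inverse t * p (t *\<^sub>R x)"
      using t by (intro assms(2)) simp
    then have "t * p x \<le> p (t *\<^sub>R x)" using t by (simp add: field_simps)
    with assms(2)[OF t] show ?thesis by (simp add: antisym)
  qed (simp add: assms(3))
  then show ?thesis using assms(1) by (auto simp: sublinear_def)
qed

lemma sublinear_zero: "sublinear p \<Longrightarrow> p 0 = 0"
  unfolding sublinear_def by (metis mult_zero_left order_refl scale_zero_left)

lemma sublinear_neg_le: "sublinear p \<Longrightarrow> - p (- x) \<le> p x"
  using sublinear_zero[of p] unfolding sublinear_def by (smt (verit) add.right_inverse)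

text \<open>Lower bounds of chains for Zorn's lemma. The values \<open>- p (- x)\<close> bound every
  member from below, so the infimum is finite; it is subadditive because any two members of a chain
  dominate a common one.\<close>

lemma sublinear_Inf_chain:
  fixes C :: "('a::real_vector \<Rightarrow> real) set"
  assumes ne: "C \<noteq> {}" and sub: "\<And>q. q \<in> C \<Longrightarrow> sublinear q \<and> q \<le> p"
    and chain: "\<And>q r. q \<in> C \<Longrightarrow> r \<in> C \<Longrightarrow> q \<le> r \<or> r \<le> q"
  shows "sublinear (\<lambda>x. INF q\<in>C. q x)" and "q \<in> C \<Longrightarrow> (\<lambda>x. INF q\<in>C. q x) \<le> q"
proof -
  have bdd: "bdd_below ((\<lambda>q. q x) ` C)" for x
  proof (rule bdd_belowI2)
    fix q assume "q \<in> C"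
    then show "- p (- x) \<le> q x"
      using sub[of q] sublinear_neg_le[of q x] by (smt (verit) le_funD)
  qed
  have low: "(INF q\<in>C. q x) \<le> q x" if "q \<in> C" for q x
    by (rule cINF_lower[OF bdd that])
  then show "q \<in> C \<Longrightarrow> (\<lambda>x. INF q\<in>C. q x) \<le> q" by (auto simp: le_fun_def)
  show "sublinear (\<lambda>x. INF q\<in>C. q x)"
  proof (rule sublinearI)
    fix x y
    have "(INF q\<in>C. q (x + y)) - q x \<le> r y" if qr: "q \<in> C" "r \<in> C" for q r
    proof -
      obtain s where s: "s \<in> C" "s \<le> q" "s \<le> r" using chain[OF qr] qr by blast
      have "(INF q\<in>C. q (x + y)) \<le> s x + s y"
        using low[OF s(1), of "x + y"] sub[OF s(1)] unfolding sublinear_def by (meson order_trans)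
      then show ?thesis using le_funD[OF s(2), of x] le_funD[OF s(3), of y] by linarith
    qed
    then have "(INF q\<in>C. q (x + y)) - q x \<le> (INF q\<in>C. q y)" if "q \<in> C" for q
      using ne that by (intro cINF_greatest) auto
    then have "(INF q\<in>C. q (x + y)) - (INF q\<in>C. q y) \<le> q x" if "q \<in> C" for q
      using that by (simp add: algebra_simps)
    then have "(INF q\<in>C. q (x + y)) - (INF q\<in>C. q y) \<le> (INF q\<in>C. q x)"
      using ne by (intro cINF_greatest) auto
    then show "(INF q\<in>C. q (x + y)) \<le> (INF q\<in>C. q x) + (INF q\<in>C. q y)" by simp
  next
    fix t :: real and x :: 'a assume t: "0 < t"
    have "(INF q\<in>C. q (t *\<^sub>R x)) / t \<le> q x" if "q \<in> C" for q
      using low[OF that, of "t *\<^sub>R x"] sub[OF that] t unfolding sublinear_def by (simp add: field_simps)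
    then have "(INF q\<in>C. q (t *\<^sub>R x)) / t \<le> (INF q\<in>C. q x)"
      using ne by (intro cINF_greatest) auto
    then show "(INF q\<in>C. q (t *\<^sub>R x)) \<le> t * (INF q\<in>C. q x)" using t by (simp add: field_simps)
  next
    have "(\<lambda>q. q 0) ` C = {0}" using ne sub sublinear_zero by fastforce
    then show "(INF q\<in>C. q 0) = 0" by simp
  qed
qed

text \<open>The infimum over \<open>t \<ge> 0\<close> of
  \<open>p (x + t *\<^sub>R y) - t * p y\<close> is a sublinear minorant of \<open>p\<close>, hence
  equals \<open>p\<close> by minimality. Taking \<open>t = 1\<close> at \<open>x = - y\<close> gives
  the inequality that subadditivity does not.\<close>

lemma sublinear_minimal_odd:
  fixes p :: "'a::real_vector \<Rightarrow> real"
  assumes p: "sublinear p" and min: "\<And>q. sublinear q \<Longrightarrow> q \<le> p \<Longrightarrow> q = p"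
  shows "p (- y) = - p y"
proof -
  have add: "p (x + z) \<le> p x + p z" for x z using p by (auto simp: sublinear_def)
  have hom: "0 \<le> t \<Longrightarrow> p (t *\<^sub>R x) = t * p x" for t x using p by (auto simp: sublinear_def)
  define q where "q x = (INF t\<in>{0..}. p (x + t *\<^sub>R y) - t * p y)" for x
  have bdd: "bdd_below ((\<lambda>t. p (x + t *\<^sub>R y) - t * p y) ` {0..})" for x
  proof (rule bdd_belowI2)
    fix t :: real assume "t \<in> {0..}"
    then show "- p (- x) \<le> p (x + t *\<^sub>R y) - t * p y"
      using add[of "x + t *\<^sub>R y" "- x"] hom[of t y] by simp
  qed
  have low: "q x \<le> p (x + t *\<^sub>R y) - t * p y" if "0 \<le> t" for t x
    unfolding q_def using that by (intro cINF_lower[OF bdd]) simp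
  have q_ge: "c \<le> q x" if "\<And>t. 0 \<le> t \<Longrightarrow> c \<le> p (x + t *\<^sub>R y) - t * p y" for c x
    unfolding q_def using that by (intro cINF_greatest) auto
  have "sublinear q"
  proof (rule sublinearI)
    fix x z
    have 1: "q (x + z) \<le> (p (x + s *\<^sub>R y) - s * p y) + (p (z + t *\<^sub>R y) - t * p y)" if "0 \<le> s" "0 \<le> t" for s t
      using low[of "s + t" "x + z"] add[of "x + s *\<^sub>R y" "z + t *\<^sub>R y"] that
      by (simp add: algebra_simps)
    have "q (x + z) - (p (x + s *\<^sub>R y) - s * p y) \<le> q z" if "0 \<le> s" for s
      by (rule q_ge) (use 1[OF that] in \<open>smt (verit)\<close>)
    then have "q (x + z) - q z \<le> q x" by (intro q_ge) (smt (verit))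
    then show "q (x + z) \<le> q x + q z" by simp
  next
    fix t :: real and x assume t: "0 < t"
    have "q (t *\<^sub>R x) / t \<le> q x"
    proof (rule q_ge)
      fix s :: real assume s: "0 \<le> s"
      have "q (t *\<^sub>R x) \<le> p (t *\<^sub>R (x + s *\<^sub>R y)) - (t * s) * p y"
        using low[of "t * s" "t *\<^sub>R x"] s t by (simp add: algebra_simps)
      then show "q (t *\<^sub>R x) / t \<le> p (x + s *\<^sub>R y) - s * p y"
        using t hom[of t "x + s *\<^sub>R y"] by (simp add: field_simps)
    qed
    then show "q (t *\<^sub>R x) \<le> t * q x" using t by (simp add: field_simps)
  next
    have "q 0 \<le> 0" using low[of 0 0] sublinear_zero[OF p] by simp
    moreover have "0 \<le> q 0" using hom by (intro q_ge) simp
    ultimately show "q 0 = 0" by simp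
  qed
  moreover have "q \<le> p" using low[of 0] by (auto simp: le_fun_def)
  ultimately have "q = p" by (rule min)
  then have "p (- y) \<le> - p y" using low[of 1 "- y"] sublinear_zero[OF p] by simp
  with sublinear_neg_le[OF p, of y] show ?thesis by simp
qed

text \<open>Hahn-Banach without an initial subspace: a minimal sublinear functional below
  \<open>p\<close> is odd, and an odd sublinear functional is linear.\<close>

lemma sublinear_dominates_linear:
  fixes p :: "'a::real_vector \<Rightarrow> real"
  assumes "sublinear p"
  obtains f where "linear f" "\<And>x. f x \<le> p x"
proof -
  define S where "S = {q. sublinear q \<and> q \<le> p}"
  \<comment> \<open>Zorn's lemma is used for the reversed order, so its maximal elements are the
    minimal functionals.\<close>
  have "\<exists>m\<in>S. \<forall>q\<in>S. m \<ge> q \<longrightarrow> q = m"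
  proof (rule predicate_Zorn)
    show "partial_order_on S (relation_of (\<ge>) S)"
      by (rule partial_order_on_relation_ofI) auto
    fix C assume C: "C \<in> Chains (relation_of (\<ge>) S)"
    show "\<exists>u\<in>S. \<forall>q\<in>C. q \<ge> u"
    proof (cases "C = {}")
      case True
      then show ?thesis using assms by (auto simp: S_def)
    next
      case False
      have CS: "C \<subseteq> S" using C by (auto simp: Chains_def relation_of_def)
      have ch: "q \<le> r \<or> r \<le> q" if "q \<in> C" "r \<in> C" for q r
        using C that by (auto simp: Chains_def relation_of_def)
      note inf = sublinear_Inf_chain[of C p, OF False _ ch]
      have s: "sublinear (\<lambda>x. INF q\<in>C. q x)" and l: "\<And>q. q \<in> C \<Longrightarrow> (\<lambda>x. INF q\<in>C. q x) \<le> q"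
        using inf CS by (auto simp: S_def)
      obtain q0 where "q0 \<in> C" using False by blast
      then have "(\<lambda>x. INF q\<in>C. q x) \<le> p" using l[of q0] CS by (auto simp: S_def intro: order_trans)
      then show ?thesis using s l by (intro bexI[of _ "\<lambda>x. INF q\<in>C. q x"]) (auto simp: S_def)
    qed
  qed
  then obtain m where m: "sublinear m" "m \<le> p" and min: "\<And>q. q \<in> S \<Longrightarrow> q \<le> m \<Longrightarrow> q = m"
    by (auto simp: S_def)
  have odd: "m (- y) = - m y" for y
    by (rule sublinear_minimal_odd[OF m(1)]) (use min m in \<open>auto simp: S_def\<close>)
  have add: "m (x + y) \<le> m x + m y" for x y using m by (auto simp: sublinear_def)
  have "linear m"
  proof (rule linearI)
    fix x y
    show "m (x + y) = m x + m y" using add[of x y] add[of "- x" "- y"] odd[of "x + y"] odd[of x] odd[of y] by simp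
    fix r
    show "m (r *\<^sub>R x) = r *\<^sub>R m x"
    proof (cases "0 \<le> r")
      case True then show ?thesis using m by (auto simp: sublinear_def)
    next
      case False
      then have "m ((- r) *\<^sub>R x) = (- r) * m x" using m unfolding sublinear_def by (metis neg_0_le_iff_le linear)
      then show ?thesis using odd[of "r *\<^sub>R x"] by simp
    qed
  qed
  then show thesis using that m(2) by (auto simp: le_fun_def)
qed

text \<open>The upper bound at \<open>x\<close> and at \<open>- x\<close> gives a two-sided bound
  for a linear minorant.\<close>

lemma sublinear_dominates_blinfun:
  fixes p :: "'a::real_normed_vector \<Rightarrow> real"
  assumes "sublinear p" and bound: "\<And>x. p x \<le> M * norm x"
  obtains f :: "'a \<Rightarrow>\<^sub>L real" where "\<And>x. f x \<le> p x"
proof -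
  obtain f where f: "linear f" "\<And>x. f x \<le> p x" using sublinear_dominates_linear[OF assms(1)] by blast
  have "norm (f x) \<le> norm x * M" for x
    using f(2)[of x] f(2)[of "- x"] bound[of x] bound[of "- x"] linear_neg[OF f(1), of x]
    by (simp add: mult.commute)
  then have "bounded_linear f"
    using f(1) by (intro bounded_linear_intro[of f M]) (auto simp: linear_add linear_scale)
  then show thesis using f(2) that[of "Blinfun f"] by (simp add: bounded_linear_Blinfun_apply)
qed

section \<open>Variational inequalities on cubes\<close>

lemma tendsto_fun_iff:
  fixes X :: "'b \<Rightarrow> 'i \<Rightarrow> 'c::topological_space"
  shows "(X \<longlongrightarrow> x) F \<longleftrightarrow> (\<forall>j. ((\<lambda>m. X m j) \<longlongrightarrow> x j) F)"
  using limitin_componentwise[of "\<lambda>_. euclidean" UNIV X x F]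
  by (simp add: euclidean_product_topology)

text \<open>Tychonoff's theorem. Points are functions on the whole index type, so the dimension is
  an ordinary number \<open>n\<close> later on and no type has to depend on it.\<close>

lemma compact_cube: "compact {x :: 'i \<Rightarrow> real. \<forall>j. \<bar>x j\<bar> \<le> R}"
proof -
  have "compactin (product_topology (\<lambda>_. euclidean) UNIV) (PiE UNIV (\<lambda>_::'i. {- R..R}))"
    by (simp add: compactin_PiE)
  moreover have "PiE UNIV (\<lambda>_::'i. {- R..R}) = {x. \<forall>j. \<bar>x j\<bar> \<le> R}"
    by (auto simp: PiE_def Pi_def abs_le_iff minus_le_iff)
  ultimately show ?thesis by (simp add: euclidean_product_topology)
qed

text \<open>Kuhn's lemma on a grid with \<open>p\<close> intervals per side yields one small cell in
  which, for each direction \<open>k\<close>, both labels occur; the corners carrying them are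
  \<open>y\<close> and \<open>z\<close>.\<close>

lemma cube_approximate_sign_change:
  fixes G :: "nat \<Rightarrow> (nat \<Rightarrow> real) \<Rightarrow> real" and p :: nat
  assumes R: "0 < R" and p: "0 < p"
  obtains x where "\<forall>j. \<bar>x j\<bar> \<le> R"
    and "\<And>k. k < n \<Longrightarrow> \<exists>y z. (\<forall>j. \<bar>y j\<bar> \<le> R \<and> \<bar>z j\<bar> \<le> R \<and> \<bar>y j - x j\<bar> \<le> 2 * R / p \<and> \<bar>z j - x j\<bar> \<le> 2 * R / p)
            \<and> (y k = - R \<or> G k y \<le> 0) \<and> (z k = R \<or> 0 \<le> G k z)"
proof -
  define pt where "pt q j = (if j < n then - R + 2 * R * real (q j) / p else 0)" for q :: "nat \<Rightarrow> nat" and j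
  \<comment> \<open>The labels on the faces \<open>q k = 0\<close> and \<open>q k = p\<close> are
    forced by Kuhn's lemma, which is why the conclusion allows \<open>y k = - R\<close> and
    \<open>z k = R\<close> instead of a sign.\<close>
  define lab where "lab q k = (if q k = 0 \<or> (q k < p \<and> G k (pt q) \<le> 0) then 0 else 1::nat)" for q k
  obtain q where q: "\<forall>i<n. q i < p"
    and rs: "\<forall>i<n. \<exists>r s. (\<forall>j<n. q j \<le> r j \<and> r j \<le> q j + 1) \<and> (\<forall>j<n. q j \<le> s j \<and> s j \<le> q j + 1) \<and> lab r i \<noteq> lab s i"
    by (rule kuhn_lemma[of p n lab]) (use p in \<open>auto simp: lab_def\<close>)
  have in_cube: "\<bar>pt r j\<bar> \<le> R" if "\<forall>j<n. r j \<le> p" for r j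
  proof (cases "j < n")
    case True
    then have "real (r j) \<le> real p" using that by simp
    then have "0 \<le> 2 * R * real (r j) / p" "2 * R * real (r j) / p \<le> 2 * R" using R p by (auto simp: field_simps)
    then show ?thesis using True by (simp add: pt_def abs_le_iff)
  qed (use R in \<open>simp add: pt_def\<close>)
  have near: "\<bar>pt r j - pt q j\<bar> \<le> 2 * R / p" if "\<forall>j<n. q j \<le> r j \<and> r j \<le> q j + 1" for r j
  proof (cases "j < n")
    case True
    have "pt r j - pt q j = 2 * R / p * (real (r j) - real (q j))" using True by (simp add: pt_def algebra_simps diff_divide_distrib)
    moreover have "0 \<le> real (r j) - real (q j)" "real (r j) - real (q j) \<le> 1" using that True by force+
    ultimately show ?thesis
      using R mult_left_le[of "real (r j) - real (q j)" "2 * R / p"] by (simp only: abs_mult) simp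
  qed (use R in \<open>simp add: pt_def\<close>)
  show thesis
  proof (rule that[of "pt q"])
    show "\<forall>j. \<bar>pt q j\<bar> \<le> R" using q in_cube[of q] by (simp add: less_imp_le)
    fix k assume k: "k < n"
    then obtain r s where r: "\<forall>j<n. q j \<le> r j \<and> r j \<le> q j + 1" and s: "\<forall>j<n. q j \<le> s j \<and> s j \<le> q j + 1"
      and l: "lab r k = 0" "lab s k = 1"
      using rs unfolding lab_def by (smt (verit, best))
    have rp: "\<forall>j<n. r j \<le> p" "\<forall>j<n. s j \<le> p" using q r s by (force)+
    have "pt r k = - R \<or> G k (pt r) \<le> 0"
      using l(1) k by (auto simp: lab_def pt_def split: if_splits)
    moreover have "pt s k = R \<or> 0 \<le> G k (pt s)"
    proof (cases "s k < p")
      case True then show ?thesis using l(2) by (auto simp: lab_def split: if_splits)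
    next
      case False
      then have "s k = p" using rp k by force
      then show ?thesis using k p by (simp add: pt_def)
    qed
    ultimately show "\<exists>y z. (\<forall>j. \<bar>y j\<bar> \<le> R \<and> \<bar>z j\<bar> \<le> R \<and> \<bar>y j - pt q j\<bar> \<le> 2 * R / p \<and> \<bar>z j - pt q j\<bar> \<le> 2 * R / p)
            \<and> (y k = - R \<or> G k y \<le> 0) \<and> (z k = R \<or> 0 \<le> G k z)"
      using in_cube[OF rp(1)] in_cube[OF rp(2)] near[OF r] near[OF s] by blast
  qed
qed

text \<open>Hartman-Stampacchia on a cube, coordinate by coordinate. As the mesh shrinks, a
  subsequence of the cells contracts to a point \<open>x\<close>, where the two sign conditions
  survive by continuity.\<close>

lemma cube_variational_inequality:
  fixes G :: "nat \<Rightarrow> (nat \<Rightarrow> real) \<Rightarrow> real"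
  assumes R: "0 < R" and cont: "\<And>k. k < n \<Longrightarrow> continuous_on {x. \<forall>j. \<bar>x j\<bar> \<le> R} (G k)"
  obtains x where "\<forall>j. \<bar>x j\<bar> \<le> R" and "\<And>k t. k < n \<Longrightarrow> \<bar>t\<bar> \<le> R \<Longrightarrow> 0 \<le> G k x * (t - x k)"
proof -
  define C where "C = {x :: nat \<Rightarrow> real. \<forall>j. \<bar>x j\<bar> \<le> R}"
  have "\<exists>x y z. x \<in> C \<and> (\<forall>k<n. y k \<in> C \<and> z k \<in> C
      \<and> (\<forall>j. \<bar>y k j - x j\<bar> \<le> 2 * R / Suc m \<and> \<bar>z k j - x j\<bar> \<le> 2 * R / Suc m)
      \<and> (y k k = - R \<or> G k (y k) \<le> 0) \<and> (z k k = R \<or> 0 \<le> G k (z k)))" for m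
  proof -
    obtain x where x: "\<forall>j. \<bar>x j\<bar> \<le> R"
      and "\<And>k. k < n \<Longrightarrow> \<exists>y z. (\<forall>j. \<bar>y j\<bar> \<le> R \<and> \<bar>z j\<bar> \<le> R \<and> \<bar>y j - x j\<bar> \<le> 2 * R / Suc m \<and> \<bar>z j - x j\<bar> \<le> 2 * R / Suc m)
            \<and> (y k = - R \<or> G k y \<le> 0) \<and> (z k = R \<or> 0 \<le> G k z)"
      using cube_approximate_sign_change[OF R, of "Suc m" n G] by blast
    then show ?thesis unfolding C_def mem_Collect_eq by metis
  qed
  then obtain X Y Z where X: "\<And>m. X m \<in> C"
    and YZ: "\<And>m k. k < n \<Longrightarrow> Y m k \<in> C \<and> Z m k \<in> C
      \<and> (\<forall>j. \<bar>Y m k j - X m j\<bar> \<le> 2 * R / Suc m \<and> \<bar>Z m k j - X m j\<bar> \<le> 2 * R / Suc m)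
      \<and> (Y m k k = - R \<or> G k (Y m k) \<le> 0) \<and> (Z m k k = R \<or> 0 \<le> G k (Z m k))"
    by metis
  obtain x \<phi> where x: "x \<in> C" and \<phi>: "strict_mono \<phi>" and lim: "(X \<circ> \<phi>) \<longlonglongrightarrow> x"
    using compact_cube[of R, where 'i=nat] X unfolding C_def[symmetric] compact_def by metis
  have limX: "(\<lambda>m. X (\<phi> m) j) \<longlonglongrightarrow> x j" for j using lim by (simp add: tendsto_fun_iff)
  have small: "(\<lambda>m. 2 * R / Suc (\<phi> m)) \<longlonglongrightarrow> 0"
  proof -
    have "(\<lambda>m. 2 * R / Suc m) \<longlonglongrightarrow> 0" using LIMSEQ_Suc[OF lim_const_over_n[of "2 * R"]] by simp
    then show ?thesis using LIMSEQ_subseq_LIMSEQ[OF _ \<phi>] by (fastforce simp: o_def)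
  qed
  have lim_near: "(\<lambda>m. W (\<phi> m)) \<longlonglongrightarrow> x" if "\<And>m j. \<bar>W m j - X m j\<bar> \<le> 2 * R / Suc m" for W
    unfolding tendsto_fun_iff
  proof
    fix j
    have "(\<lambda>m. W (\<phi> m) j - X (\<phi> m) j) \<longlonglongrightarrow> 0"
      by (rule Lim_null_comparison[OF _ small]) (use that in auto)
    from tendsto_add[OF this limX[of j]] show "(\<lambda>m. W (\<phi> m) j) \<longlonglongrightarrow> x j" by simp
  qed
  show thesis
  proof (rule that[of x])
    show "\<forall>j. \<bar>x j\<bar> \<le> R" using x by (simp add: C_def)
    fix k and t :: real assume k: "k < n" and t: "\<bar>t\<bar> \<le> R"
    have limG: "(\<lambda>m. G k (W (\<phi> m))) \<longlonglongrightarrow> G k x" if "(\<lambda>m. W (\<phi> m)) \<longlonglongrightarrow> x" "\<And>m. W m \<in> C" for W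
      by (rule continuous_on_tendsto_compose[OF cont[OF k, folded C_def] that(1) x]) (simp add: that(2))
    have Y: "(\<lambda>m. Y (\<phi> m) k) \<longlonglongrightarrow> x" and Z: "(\<lambda>m. Z (\<phi> m) k) \<longlonglongrightarrow> x"
      using YZ[OF k] by (auto intro!: lim_near)
    note GY = limG[of "\<lambda>m. Y m k", OF Y] and GZ = limG[of "\<lambda>m. Z m k", OF Z]
    \<comment> \<open>Away from the lower face the alternative \<open>Y (\<phi> m) k k = - R\<close>
      fails eventually, so the sign condition is the one that remains; the upper face is
      symmetric.\<close>
    have neg: "G k x \<le> 0" if "x k \<noteq> - R"
    proof (rule tendsto_upperbound[OF GY])
      have "\<forall>\<^sub>F m in sequentially. Y (\<phi> m) k k \<noteq> - R"
        using Y that by (intro tendsto_imp_eventually_ne) (auto simp: tendsto_fun_iff)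
      then show "\<forall>\<^sub>F m in sequentially. G k (Y (\<phi> m) k) \<le> 0"
        by eventually_elim (use YZ[OF k] in auto)
    qed (use YZ[OF k] in auto)
    have pos: "0 \<le> G k x" if "x k \<noteq> R"
    proof (rule tendsto_lowerbound[OF GZ])
      have "\<forall>\<^sub>F m in sequentially. Z (\<phi> m) k k \<noteq> R"
        using Z that by (intro tendsto_imp_eventually_ne) (auto simp: tendsto_fun_iff)
      then show "\<forall>\<^sub>F m in sequentially. 0 \<le> G k (Z (\<phi> m) k)"
        by eventually_elim (use YZ[OF k] in auto)
    qed (use YZ[OF k] in auto)
    consider "x k = - R" | "x k = R" | "G k x = 0" using neg pos by force
    then show "0 \<le> G k x * (t - x k)"
    proof cases
      case 1
      then show ?thesis using pos R t by simp
    next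
      case 2
      then show ?thesis using neg R t by (simp add: mult_nonpos_nonpos)
    qed simp
  qed
qed

section \<open>The Clarke subdifferential\<close>

abbreviation clarke_filter :: "'a::real_normed_vector \<Rightarrow> ('a \<times> real) filter" where
  "clarke_filter x \<equiv> at (x, 0) within (UNIV \<times> {0<..})"

text \<open>Serves to verify the changes of variable in base point and step length behind the
  sublinearity of the Clarke derivative.\<close>

lemma filterlim_clarke_filter:
  "filterlim g (clarke_filter x) F \<longleftrightarrow>
     ((\<lambda>s. fst (g s)) \<longlongrightarrow> x) F \<and> ((\<lambda>s. snd (g s)) \<longlongrightarrow> 0) F \<and> (\<forall>\<^sub>F s in F. 0 < snd (g s))"
proof -
  have "(g \<longlongrightarrow> (x, 0)) F \<longleftrightarrow> ((\<lambda>s. fst (g s)) \<longlongrightarrow> x) F \<and> ((\<lambda>s. snd (g s)) \<longlongrightarrow> 0) F"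
    using tendsto_fst[of g "(x, 0)" F] tendsto_snd[of g "(x, 0)" F]
      tendsto_Pair[of "\<lambda>s. fst (g s)" x F "\<lambda>s. snd (g s)" 0] by auto
  moreover have "(\<forall>\<^sub>F s in F. g s \<in> UNIV \<times> {0<..} \<and> g s \<noteq> (x, 0)) \<longleftrightarrow> (\<forall>\<^sub>F s in F. 0 < snd (g s))"
    by (intro arg_cong[of _ _ "\<lambda>P. eventually P F"] ext) (metis UNIV_I greaterThan_iff less_irrefl mem_Times_iff snd_conv)
  ultimately show ?thesis unfolding filterlim_at by blast
qed

lemma eventually_clarke_filter:
  "(\<forall>\<^sub>F s in clarke_filter x. P s) \<longleftrightarrow>
     (\<exists>r>0. \<forall>y l. dist y x < r \<and> 0 < l \<and> l < r \<longrightarrow> P (y, l))"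
proof
  assume "\<forall>\<^sub>F s in clarke_filter x. P s"
  then obtain e where "0 < e" and e: "\<And>y l. 0 < l \<Longrightarrow> dist (y, l) (x, 0) < e \<Longrightarrow> P (y, l)"
    unfolding eventually_at by force
  moreover have "dist (y, l) (x, 0) < e" if "dist y x < e / 2" "0 < l" "l < e / 2" for y and l :: real
    using sqrt_sum_squares_le_sum_abs[of "dist y x" l] that by (simp add: dist_Pair_Pair)
  ultimately show "\<exists>r>0. \<forall>y l. dist y x < r \<and> 0 < l \<and> l < r \<longrightarrow> P (y, l)"
    by (intro exI[of _ "e / 2"]) auto
next
  assume "\<exists>r>0. \<forall>y l. dist y x < r \<and> 0 < l \<and> l < r \<longrightarrow> P (y, l)"
  then obtain r where "0 < r" and r: "\<And>y l. dist y x < r \<Longrightarrow> 0 < l \<Longrightarrow> l < r \<Longrightarrow> P (y, l)" by blast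
  have "P s" if "s \<in> UNIV \<times> {0<..}" "dist s (x, 0) < r" for s
  proof -
    have "dist (fst s) x < r" "dist (snd s) 0 < r"
      using dist_fst_le[of s "(x, 0)"] dist_snd_le[of s "(x, 0)"] that(2) by auto
    then show ?thesis using r[of "fst s" "snd s"] that(1) by (auto simp: mem_Times_iff)
  qed
  then show "\<forall>\<^sub>F s in clarke_filter x. P s"
    unfolding eventually_at using \<open>0 < r\<close> by blast
qed

lemma clarke_filter_neq_bot [simp]: "clarke_filter x \<noteq> bot"
proof
  assume "clarke_filter x = bot"
  then have "\<forall>\<^sub>F s in clarke_filter x. False" by simp
  then obtain r :: real where "0 < r" "\<And>y l. dist y x < r \<Longrightarrow> 0 < l \<Longrightarrow> l < r \<Longrightarrow> False"
    unfolding eventually_clarke_filter by blast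
  from this(2)[of x "r / 2"] this(1) show False by simp
qed

text \<open>Both \<open>y\<close> and \<open>y + l *\<^sub>R v\<close> eventually lie in a ball
  where \<open>J\<close> is Lipschitz, so one \<open>L\<close> serves all directions
  \<open>v\<close>.\<close>

lemma clarke_quotient_bound:
  fixes J :: "'a::real_normed_vector \<Rightarrow> real"
  assumes "locally_lipschitz J"
  obtains L where "\<And>v. \<forall>\<^sub>F s in clarke_filter x. \<bar>J (fst s + snd s *\<^sub>R v) - J (fst s)\<bar> \<le> L * norm v * snd s"
proof -
  obtain r L where "0 < r" and L: "L-lipschitz_on (ball x r) J"
    using assms unfolding locally_lipschitz_def by blast
  show thesis
  proof (rule that[of L])
    fix v
    have "((\<lambda>s. fst s) \<longlongrightarrow> x) (clarke_filter x)" and "((\<lambda>s. snd s) \<longlongrightarrow> 0) (clarke_filter x)"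
      and pos: "\<forall>\<^sub>F s in clarke_filter x. 0 < snd s"
      using filterlim_clarke_filter[of "\<lambda>s. s" x "clarke_filter x"] by (auto simp: filterlim_ident)
    note lim = this(1,2)
    have "((\<lambda>s. fst s + snd s *\<^sub>R v) \<longlongrightarrow> x + 0 *\<^sub>R v) (clarke_filter x)"
      by (intro tendsto_intros lim)
    then have "\<forall>\<^sub>F s in clarke_filter x. fst s + snd s *\<^sub>R v \<in> ball x r"
      using \<open>0 < r\<close> by (intro topological_tendstoD) auto
    moreover have "\<forall>\<^sub>F s in clarke_filter x. fst s \<in> ball x r"
      using \<open>0 < r\<close> lim(1) by (intro topological_tendstoD) auto
    ultimately show "\<forall>\<^sub>F s in clarke_filter x. \<bar>J (fst s + snd s *\<^sub>R v) - J (fst s)\<bar> \<le> L * norm v * snd s"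
      using pos
      by eventually_elim (use lipschitz_onD[OF L] in \<open>fastforce simp: dist_norm mult_ac\<close>)
  qed
qed

text \<open>The Lipschitz bound makes the Clarke derivative finite; it is sublinear in the
  direction, and Hahn-Banach provides a bounded linear minorant.\<close>

lemma clarke_subdiff_nonempty:
  fixes J :: "'a::real_normed_vector \<Rightarrow> real"
  assumes "locally_lipschitz J"
  obtains \<xi> where "\<xi> \<in> clarke_subdiff J x"
proof -
  define F where "F = clarke_filter x"
  define Q where "Q v s = J (fst s + snd s *\<^sub>R v) - J (fst s)" for v s
  \<comment> \<open>The limsup is encoded as the infimum of eventual upper bounds, with the quotient
    multiplied out; this keeps \<open>p\<close> real-valued.\<close>
  define S where "S v = {r. \<forall>\<^sub>F s in F. Q v s \<le> r * snd s}" for v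
  define p where "p v = Inf (S v)" for v
  have lim: "((\<lambda>s. fst s) \<longlongrightarrow> x) F" "((\<lambda>s. snd s) \<longlongrightarrow> 0) F" and pos: "\<forall>\<^sub>F s in F. 0 < snd s"
    using filterlim_clarke_filter[of "\<lambda>s. s" x F] by (auto simp: F_def filterlim_ident)
  obtain L where L: "\<And>v. \<forall>\<^sub>F s in F. \<bar>Q v s\<bar> \<le> L * norm v * snd s"
    using clarke_quotient_bound[OF assms, of x] unfolding F_def Q_def by blast
  have LS: "L * norm v \<in> S v" for v
    unfolding S_def using L[of v] by (auto elim: eventually_mono)
  have S_ge: "- (L * norm v) \<le> r" if "r \<in> S v" for r v
  proof -
    have "\<forall>\<^sub>F s in F. - (L * norm v) \<le> r"
      using L[of v] that[unfolded S_def mem_Collect_eq] pos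
    proof eventually_elim
      case (elim s)
      then have "- (L * norm v) * snd s \<le> r * snd s" by (simp add: abs_le_iff)
      then show ?case using elim(3) by (simp only: mult_le_cancel_right_pos)
    qed
    then show ?thesis using clarke_filter_neq_bot[of x] by (simp add: F_def)
  qed
  then have bdd: "bdd_below (S v)" for v by (intro bdd_belowI) auto
  have p_le: "p v \<le> r" if "r \<in> S v" for r v unfolding p_def by (rule cInf_lower[OF that bdd])
  have p_ge: "c \<le> p v" if "\<And>r. r \<in> S v \<Longrightarrow> c \<le> r" for c v
    unfolding p_def using LS[of v] that by (intro cInf_greatest) auto
  have "sublinear p"
  proof (rule sublinearI)
    fix v w
    have add: "r + q \<in> S (v + w)" if "r \<in> S v" "q \<in> S w" for r q
    proof -
      \<comment> \<open>The increment along \<open>v + w\<close> is the increment along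
        \<open>w\<close> from \<open>y\<close> plus the one along \<open>v\<close> from
        \<open>y + l *\<^sub>R w\<close>; the moved base point still tends to
        \<open>x\<close>.\<close>
      have "((\<lambda>s. fst s + snd s *\<^sub>R w) \<longlongrightarrow> x + 0 *\<^sub>R w) F" by (intro tendsto_intros lim)
      then have "filterlim (\<lambda>s. (fst s + snd s *\<^sub>R w, snd s)) F F"
        using lim(2) pos unfolding F_def filterlim_clarke_filter by simp
      from eventually_compose_filterlim[OF that(1)[unfolded S_def mem_Collect_eq] this]
      have "\<forall>\<^sub>F s in F. Q v (fst s + snd s *\<^sub>R w, snd s) \<le> r * snd s" by simp
      with that(2)[unfolded S_def mem_Collect_eq]
      have "\<forall>\<^sub>F s in F. Q (v + w) s \<le> (r + q) * snd s"
        by eventually_elim (simp add: Q_def algebra_simps)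
      then show ?thesis by (simp add: S_def)
    qed
    have "p (v + w) - r \<le> p w" if "r \<in> S v" for r
      by (rule p_ge) (use p_le[OF add[OF that]] in \<open>smt (verit)\<close>)
    then have "p (v + w) - p w \<le> p v" by (intro p_ge) (smt (verit))
    then show "p (v + w) \<le> p v + p w" by simp
  next
    fix t :: real and v assume t: "0 < t"
    have "p (t *\<^sub>R v) / t \<le> p v"
    proof (rule p_ge)
      fix r assume r: "r \<in> S v"
      \<comment> \<open>A step of length \<open>l\<close> along \<open>t *\<^sub>R v\<close> is a
        step of length \<open>t * l\<close> along \<open>v\<close>.\<close>
      have "((\<lambda>s. t * snd s) \<longlongrightarrow> t * 0) F" by (intro tendsto_intros lim)
      then have "filterlim (\<lambda>s. (fst s, t * snd s)) F F"
        using lim(1) pos t unfolding F_def filterlim_clarke_filter by (simp add: zero_less_mult_iff)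
      from eventually_compose_filterlim[OF r[unfolded S_def mem_Collect_eq] this]
      have "\<forall>\<^sub>F s in F. Q (t *\<^sub>R v) s \<le> (t * r) * snd s"
        by (simp add: Q_def mult_ac)
      then have "p (t *\<^sub>R v) \<le> t * r" by (intro p_le) (simp add: S_def)
      then show "p (t *\<^sub>R v) / t \<le> r" using t by (simp add: field_simps)
    qed
    then show "p (t *\<^sub>R v) \<le> t * p v" using t by (simp add: field_simps)
  next
    have "p 0 \<le> 0" using p_le[OF LS[of 0]] by simp
    moreover have "0 \<le> p 0" by (rule p_ge) (use S_ge[of _ 0] in simp)
    ultimately show "p 0 = 0" by simp
  qed
  moreover have "p v \<le> L * norm v" for v by (rule p_le[OF LS])
  ultimately obtain \<xi> :: "'a \<Rightarrow>\<^sub>L real" where \<xi>: "\<And>v. \<xi> v \<le> p v"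
    using sublinear_dominates_blinfun by blast
  have "ereal (\<xi> v) \<le> clarke_dd J x v" for v
  proof (rule ccontr)
    assume "\<not> ?thesis"
    then have "clarke_dd J x v < ereal (\<xi> v)" by (simp only: not_le)
    from ereal_dense2[OF this] obtain r where r: "clarke_dd J x v < ereal r" "ereal r < ereal (\<xi> v)"
      by blast
    have "\<forall>\<^sub>F s in F. Q v s \<le> r * snd s"
      using Limsup_lessD[OF r(1)[unfolded clarke_dd_def]] pos unfolding F_def
      by eventually_elim (auto simp: Q_def field_simps split: prod.splits)
    then have "p v \<le> r" by (intro p_le) (simp add: S_def)
    with \<xi>[of v] r(2) show False by simp
  qed
  then show thesis using that[of \<xi>] by (simp add: clarke_subdiff_def)
qed

text \<open>A bound \<open>r\<close> for the quotients on a box of size \<open>\<rho>\<close> around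
  \<open>x\<close> holds on the box of half that size around each nearby \<open>z\<close>, hence
  bounds the Clarke derivative at \<open>z\<close>.\<close>

lemma clarke_subdiff_upper_semicontinuous:
  assumes "clarke_dd J x v < ereal r"
  obtains \<rho> where "0 < \<rho>" and "\<forall>z \<xi>. dist z x < \<rho> \<longrightarrow> \<xi> \<in> clarke_subdiff J z \<longrightarrow> \<xi> v \<le> r"
proof -
  obtain \<rho> where "0 < \<rho>"
    and \<rho>: "\<And>y l. dist y x < \<rho> \<Longrightarrow> 0 < l \<Longrightarrow> l < \<rho> \<Longrightarrow> ereal ((J (y + l *\<^sub>R v) - J y) / l) < ereal r"
    using Limsup_lessD[OF assms[unfolded clarke_dd_def]] unfolding eventually_clarke_filter by auto
  show thesis
  proof (rule that[of "\<rho> / 2"])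
    show "\<forall>z \<xi>. dist z x < \<rho> / 2 \<longrightarrow> \<xi> \<in> clarke_subdiff J z \<longrightarrow> \<xi> v \<le> r"
    proof (intro allI impI)
      fix z \<xi> assume z: "dist z x < \<rho> / 2" and \<xi>: "\<xi> \<in> clarke_subdiff J z"
      have "\<forall>\<^sub>F (y, l) in clarke_filter z. ereal ((J (y + l *\<^sub>R v) - J y) / l) \<le> ereal r"
        unfolding eventually_clarke_filter
      proof (intro exI[of _ "\<rho> / 2"] conjI allI impI)
        fix y and l :: real assume "dist y z < \<rho> / 2 \<and> 0 < l \<and> l < \<rho> / 2"
        moreover from this have "dist y x < \<rho>" using z dist_triangle[of y x z] by linarith
        ultimately show "case (y, l) of (y, l) \<Rightarrow> ereal ((J (y + l *\<^sub>R v) - J y) / l) \<le> ereal r"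
          using \<rho>[of y l] by (simp add: less_imp_le)
      qed (use \<open>0 < \<rho>\<close> in simp)
      then have "clarke_dd J z v \<le> ereal r"
        unfolding clarke_dd_def by (intro Limsup_bounded) (simp add: case_prod_unfold)
      moreover have "ereal (\<xi> v) \<le> clarke_dd J z v" using \<xi> by (simp add: clarke_subdiff_def)
      ultimately show "\<xi> v \<le> r" by (metis ereal_less_eq(3) order_trans)
    qed
  qed (use \<open>0 < \<rho>\<close> in simp)
qed

section \<open>Continuous selections, compactness and pseudomonotonicity\<close>

text \<open>A partition of unity made of the hat functions
  \<open>max 0 (\<epsilon> - dist y z)\<close> over a finite \<open>\<epsilon>\<close>-net mixes
  arbitrarily chosen values. Only net points closer than \<open>\<epsilon>\<close> to
  \<open>z\<close> get positive weight.\<close>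

lemma approximate_continuous_selection:
  fixes F :: "'a::metric_space \<Rightarrow> 'b::real_normed_vector set"
  assumes K: "compact K" and ne: "\<And>z. z \<in> K \<Longrightarrow> F z \<noteq> {}" and \<epsilon>: "0 < \<epsilon>"
  obtains S where "continuous_on K S" and "\<And>z. z \<in> K \<Longrightarrow> S z \<in> convex hull (\<Union>y \<in> ball z \<epsilon>. F y)"
proof -
  obtain D where D: "finite D" "D \<subseteq> K" "K \<subseteq> (\<Union>y\<in>D. ball y \<epsilon>)"
    using K \<epsilon> by (elim compactE_image[of K K "\<lambda>y. ball y \<epsilon>"]) auto
  define \<phi> where "\<phi> y z = max 0 (\<epsilon> - dist y z)" for y z :: 'a
  define s where "s z = (\<Sum>y\<in>D. \<phi> y z)" for z
  have s_pos: "0 < s z" if zK: "z \<in> K" for z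
  proof -
    obtain y where "y \<in> D" "dist y z < \<epsilon>" using D(3) zK by force
    then show ?thesis unfolding s_def using D(1) by (intro sum_pos2[of D y]) (auto simp: \<phi>_def)
  qed
  define \<xi> where "\<xi> y = (SOME w. w \<in> F y)" for y
  have \<xi>: "\<xi> y \<in> F y" if "y \<in> K" for y unfolding \<xi>_def using ne[OF that] by (simp add: some_in_eq)
  define S where "S z = (\<Sum>y\<in>D. (\<phi> y z / s z) *\<^sub>R \<xi> y)" for z
  show thesis
  proof (rule that[of S])
    show "continuous_on K S"
    proof -
      have "continuous_on K (\<phi> y)" for y unfolding \<phi>_def by (intro continuous_intros)
      moreover from this have "continuous_on K s" unfolding s_def by (intro continuous_on_sum)
      moreover have "\<forall>z\<in>K. s z \<noteq> 0" using s_pos by fastforce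
      ultimately show ?thesis
        unfolding S_def by (intro continuous_on_sum continuous_on_scaleR continuous_on_divide continuous_on_const)
    qed
    fix z assume z: "z \<in> K"
    define D' where "D' = {y \<in> D. dist y z < \<epsilon>}"
    have D': "finite D'" "D' \<subseteq> D" using D(1) by (auto simp: D'_def)
    have off: "\<phi> y z = 0" if "y \<in> D - D'" for y using that by (auto simp: D'_def \<phi>_def)
    have "S z = (\<Sum>y\<in>D'. (\<phi> y z / s z) *\<^sub>R \<xi> y)"
      unfolding S_def using D(1) D' off by (intro sum.mono_neutral_right) auto
    moreover have "\<dots> \<in> convex hull (\<Union>y \<in> ball z \<epsilon>. F y)"
    proof (rule convex_sum[OF D'(1) convex_convex_hull])
      have "(\<Sum>y\<in>D'. \<phi> y z) = s z"
        unfolding s_def using D(1) D' off by (intro sum.mono_neutral_left) auto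
      then show "(\<Sum>y\<in>D'. \<phi> y z / s z) = 1" using s_pos[OF z] by (simp flip: sum_divide_distrib)
      show "\<And>y. y \<in> D' \<Longrightarrow> 0 \<le> \<phi> y z / s z" using s_pos[OF z] by (auto simp: \<phi>_def)
      show "\<And>y. y \<in> D' \<Longrightarrow> \<xi> y \<in> convex hull (\<Union>y \<in> ball z \<epsilon>. F y)"
        using \<xi> D(2) by (intro hull_inc) (force simp: D'_def dist_commute)
    qed
    ultimately show "S z \<in> convex hull (\<Union>y \<in> ball z \<epsilon>. F y)" by simp
  qed
qed

section \<open>Ehrling's inequality and weak compactness\<close>

lemma compact_map_subseq:
  assumes "compact_map K" and "bounded (range v)"
  obtains \<phi> l where "strict_mono (\<phi> :: nat \<Rightarrow> nat)" and "(\<lambda>n. K (v (\<phi> n))) \<longlonglongrightarrow> l"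
proof -
  have "compact (closure (K ` range v))" using assms by (auto simp: compact_map_def)
  moreover have "\<forall>n. (K \<circ> v) n \<in> closure (K ` range v)" using closure_subset by fastforce
  ultimately obtain l \<phi> where "strict_mono \<phi>" "((K \<circ> v) \<circ> \<phi>) \<longlonglongrightarrow> l"
    unfolding compact_def by blast
  then show thesis using that by (simp add: o_def)
qed

text \<open>Otherwise there are unit vectors \<open>w n\<close> with
  \<open>norm (j (w n)) > \<epsilon> + n * norm (k (j (w n)))\<close>. Compactness gives a limit
  \<open>z\<close> of their images with \<open>k z = 0\<close>, so \<open>z = 0\<close> by
  injectivity, contradicting \<open>norm z \<ge> \<epsilon>\<close>.\<close>

lemma ehrling:
  fixes j :: "'v::real_normed_vector \<Rightarrow> 'z::real_normed_vector" and k :: "'z \<Rightarrow> 'h::real_normed_vector"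
  assumes j: "bounded_linear j" "compact_map j" and k: "bounded_linear k" "inj k" and \<epsilon>: "0 < \<epsilon>"
  obtains C where "0 \<le> C" and "\<And>v. norm (j v) \<le> \<epsilon> * norm v + C * norm (k (j v))"
proof (rule ccontr)
  assume "\<not> thesis"
  with that have "\<forall>n. \<exists>v. \<epsilon> * norm v + real n * norm (k (j v)) < norm (j v)"
    by (meson not_le of_nat_0_le_iff)
  then obtain v where v: "\<And>n. \<epsilon> * norm (v n) + real n * norm (k (j (v n))) < norm (j (v n))" by metis
  interpret j: bounded_linear j by fact
  interpret k: bounded_linear k by fact
  have nz: "v n \<noteq> 0" for n using v[of n] j.zero k.zero by force
  define w where "w n = v n /\<^sub>R norm (v n)" for n
  have nw: "norm (w n) = 1" for n using nz by (simp add: w_def)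
  have w: "\<epsilon> + real n * norm (k (j (w n))) < norm (j (w n))" for n
  proof -
    have "norm (j (w n)) = norm (j (v n)) / norm (v n)"
      and "norm (k (j (w n))) = norm (k (j (v n))) / norm (v n)"
      by (simp_all add: w_def j.scaleR k.scaleR divide_inverse_commute)
    moreover have "0 < norm (v n)" using nz by simp
    ultimately show ?thesis using v[of n] by (simp add: pos_less_divide_eq add_divide_distrib distrib_right)
  qed
  have "bounded (range w)" using nw by (intro boundedI[of _ 1]) auto
  then obtain \<phi> z where \<phi>: "strict_mono (\<phi> :: nat \<Rightarrow> nat)" and z: "(\<lambda>n. j (w (\<phi> n))) \<longlonglongrightarrow> z"
    using compact_map_subseq[OF j(2)] by metis
  obtain M where M: "\<And>x. norm (j x) \<le> norm x * M" using j.bounded by blast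
  have "(\<lambda>n. k (j (w n))) \<longlonglongrightarrow> 0"
  proof (rule Lim_null_comparison)
    show "\<forall>\<^sub>F n in sequentially. norm (k (j (w n))) \<le> M / real n"
      using eventually_gt_at_top[of 0]
    proof eventually_elim
      case (elim n)
      have "real n * norm (k (j (w n))) \<le> M" using w[of n] M[of "w n"] nw[of n] \<epsilon> by simp
      then show ?case using elim by (simp add: field_simps)
    qed
    show "(\<lambda>n. M / real n) \<longlonglongrightarrow> 0" by (rule lim_const_over_n)
  qed
  then have "(\<lambda>n. k (j (w (\<phi> n)))) \<longlonglongrightarrow> 0" using LIMSEQ_subseq_LIMSEQ[OF _ \<phi>] by (fastforce simp: o_def)
  moreover have "(\<lambda>n. k (j (w (\<phi> n)))) \<longlonglongrightarrow> k z" by (rule k.tendsto[OF z])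
  ultimately have "k z = k 0" using LIMSEQ_unique k.zero by metis
  then have "z = 0" by (rule injD[OF k(2)])
  moreover have "\<epsilon> \<le> norm z"
  proof (rule tendsto_lowerbound[OF tendsto_norm[OF z]])
    have "\<epsilon> \<le> norm (j (w n))" for n
      using w[of n] by (smt (verit) mult_nonneg_nonneg norm_ge_zero of_nat_0_le_iff)
    then show "\<forall>\<^sub>F n in sequentially. \<epsilon> \<le> norm (j (w (\<phi> n)))" by simp
  qed simp
  ultimately show False using \<epsilon> by simp
qed

text \<open>Functionals induced by \<open>H\<close> are dense in the dual of \<open>V\<close>, so strong convergence of the images
  in \<open>H\<close> already forces weak convergence in \<open>V\<close>; no diagonal argument is needed.\<close>

lemma bounded_weakly_convergent_subseq:
  fixes i :: "'v::real_normed_vector \<Rightarrow>\<^sub>L 'h::real_inner"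
  assumes refl: "reflexive_space TYPE('v)" and comp: "compact_map i"
    and dense: "\<And>g :: 'v \<Rightarrow>\<^sub>L real. \<And>e. 0 < e \<Longrightarrow> \<exists>h. \<forall>v. \<bar>g v - inner h (i v)\<bar> \<le> e * norm v"
    and bdd: "\<And>n. norm (v n) \<le> M"
  obtains \<phi> u where "strict_mono (\<phi> :: nat \<Rightarrow> nat)" and "weakly_convergent (\<lambda>n. v (\<phi> n)) u"
    and "(\<lambda>n. i (v (\<phi> n))) \<longlonglongrightarrow> i u"
proof -
  have M: "0 \<le> M" using bdd[of 0] norm_ge_zero order_trans by blast
  have "bounded (range v)" using bdd by (intro boundedI) auto
  then obtain \<phi> h where \<phi>: "strict_mono (\<phi> :: nat \<Rightarrow> nat)" and h: "(\<lambda>n. i (v (\<phi> n))) \<longlonglongrightarrow> h"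
    using compact_map_subseq[OF comp] by metis
  define w where "w n = v (\<phi> n)" for n
  have conv: "convergent (\<lambda>n. g (w n))" for g :: "'v \<Rightarrow>\<^sub>L real"
  proof (rule Cauchy_convergent, rule CauchyI)
    fix e :: real assume e: "0 < e"
    \<comment> \<open>Differences of members have norm at most \<open>2 * M\<close>, so replacing
      \<open>g\<close> by a functional from the Hilbert space costs less than
      \<open>e / 2\<close>.\<close>
    define e' where "e' = e / (4 * (M + 1))"
    have e': "0 < e'" "e' * (2 * M) < e / 2" using e M by (auto simp: e'_def field_simps)
    obtain k where k: "\<And>v. \<bar>g v - inner k (i v)\<bar> \<le> e' * norm v" using dense[OF e'(1)] by blast
    have "(\<lambda>n. inner k (i (w n))) \<longlonglongrightarrow> inner k h" unfolding w_def by (intro tendsto_intros h)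
    then have "Cauchy (\<lambda>n. inner k (i (w n)))" by (rule LIMSEQ_imp_Cauchy)
    then obtain N where N: "\<And>m n. N \<le> m \<Longrightarrow> N \<le> n \<Longrightarrow> \<bar>inner k (i (w m)) - inner k (i (w n))\<bar> < e / 2"
      using e unfolding Cauchy_iff by (metis half_gt_zero real_norm_def)
    have "norm (g (w m) - g (w n)) < e" if "N \<le> m" "N \<le> n" for m n
    proof -
      have "norm (w m - w n) \<le> 2 * M"
        using norm_triangle_ineq4[of "w m" "w n"] bdd[of "\<phi> m"] bdd[of "\<phi> n"] by (simp add: w_def)
      then have "e' * norm (w m - w n) < e / 2"
        using e' mult_left_mono[of "norm (w m - w n)" "2 * M" e'] by linarith
      then show ?thesis
        using k[of "w m - w n"] N[OF that]
        unfolding blinfun.diff_right inner_diff_right real_norm_def by linarith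
    qed
    then show "\<exists>N. \<forall>m\<ge>N. \<forall>n\<ge>N. norm (g (w m) - g (w n)) < e" by blast
  qed
  \<comment> \<open>The pointwise limit is an element of the bidual; reflexivity represents it by
    the weak limit \<open>u\<close>.\<close>
  define L where "L g = lim (\<lambda>n. g (w n))" for g :: "'v \<Rightarrow>\<^sub>L real"
  have L: "(\<lambda>n. g (w n)) \<longlonglongrightarrow> L g" for g :: "'v \<Rightarrow>\<^sub>L real"
    using conv unfolding L_def by (simp add: convergent_LIMSEQ_iff)
  have "bounded_linear L"
  proof (rule bounded_linear_intro)
    fix f g :: "'v \<Rightarrow>\<^sub>L real" and r :: real
    show "L (f + g) = L f + L g"
      using tendsto_add[OF L[of f] L[of g]] by (intro LIMSEQ_unique[OF L]) (simp add: blinfun.add_left)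
    show "L (r *\<^sub>R f) = r *\<^sub>R L f"
      using tendsto_scaleR[OF tendsto_const L[of f], of r] by (intro LIMSEQ_unique[OF L]) (simp add: blinfun.scaleR_left)
    show "norm (L f) \<le> norm f * M"
    proof (rule tendsto_upperbound[OF tendsto_norm[OF L]])
      show "\<forall>\<^sub>F n in sequentially. norm (f (w n)) \<le> norm f * M"
        using norm_blinfun[of f] bdd
        by (intro always_eventually allI) (metis (no_types) mult_left_mono norm_ge_zero order_trans w_def)
    qed simp
  qed
  then obtain u where u: "\<And>g. L g = blinfun_apply g u"
    using refl bounded_linear_Blinfun_apply[of L] unfolding reflexive_space_def by metis
  have weak: "weakly_convergent w u" using L u by (simp add: weakly_convergent_def)
  \<comment> \<open>The strong limit \<open>h\<close> and the image of the weak limit are compared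
    by testing with their own difference.\<close>
  have "h = i u"
  proof -
    have "inner (h - i u) h = inner (h - i u) (i u)"
    proof (rule LIMSEQ_unique)
      show "(\<lambda>n. inner (h - i u) (i (w n))) \<longlonglongrightarrow> inner (h - i u) h"
        unfolding w_def by (intro tendsto_intros h)
      show "(\<lambda>n. inner (h - i u) (i (w n))) \<longlonglongrightarrow> inner (h - i u) (i u)"
        using L[of "blinfun_inner_right (h - i u) o\<^sub>L i"] by (simp add: u)
    qed
    then have "inner (h - i u) (h - i u) = 0" by (simp add: inner_diff_right)
    then show ?thesis by simp
  qed
  with \<phi> weak h that show thesis unfolding w_def by blast
qed

section \<open>Pseudomonotone operators\<close>

lemma tendsto_weakly_convergent: "v \<longlonglongrightarrow> u \<Longrightarrow> weakly_convergent v u"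
  by (auto simp: weakly_convergent_def intro: tendsto_intros)

text \<open>The limsup condition removes \<open>A (v n) (v n - u)\<close> from the liminf
  inequality, leaving a lower bound for \<open>A (v n) w\<close>; since \<open>w\<close> is
  arbitrary, \<open>- w\<close> gives the upper bound.\<close>

lemma pseudomonotone_weak_limit:
  assumes pm: "pseudomonotone A" and weak: "weakly_convergent v u"
    and limsup: "\<And>e. 0 < e \<Longrightarrow> \<forall>\<^sub>F n in sequentially. A (v n) (v n - u) \<le> e"
  shows "(\<lambda>n. A (v n) w) \<longlonglongrightarrow> A u w"
proof -
  have "limsup (\<lambda>n. ereal (A (v n) (v n - u))) \<le> 0"
    unfolding Limsup_le_iff
  proof (intro allI impI)
    fix y :: ereal assume "0 < y"
    then obtain e where e: "0 < ereal e" "ereal e < y" using ereal_dense2 by blast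
    then show "\<forall>\<^sub>F n in sequentially. ereal (A (v n) (v n - u)) < y"
      using eventually_mono[OF limsup[of e]] by (simp add: le_less_trans[OF _ e(2)])
  qed
  then have liminf: "ereal (A u (u - y)) \<le> liminf (\<lambda>n. ereal (A (v n) (v n - y)))" for y
    using pm weak unfolding pseudomonotone_def by blast
  have low: "\<forall>\<^sub>F n in sequentially. A u w - e < A (v n) w" if e: "0 < e" for e w
  proof -
    \<comment> \<open>The test point \<open>u - w\<close> makes \<open>u - y\<close> equal to
      \<open>w\<close>.\<close>
    have "ereal (A u w - e / 2) < liminf (\<lambda>n. ereal (A (v n) (v n - (u - w))))"
      using e by (intro less_le_trans[OF _ liminf]) simp
    from less_LiminfD[OF this]
    have "\<forall>\<^sub>F n in sequentially. A u w - e / 2 < A (v n) (v n - u) + A (v n) w"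
      by (simp add: blinfun.diff_right blinfun.add_right algebra_simps)
    with limsup[of "e / 2"] e show ?thesis by (auto elim: eventually_elim2)
  qed
  show ?thesis
  proof (rule tendstoI)
    fix e :: real assume "0 < e"
    from low[OF this, of w] low[OF this, of "- w"]
    show "\<forall>\<^sub>F n in sequentially. dist (A (v n) w) (A u w) < e"
      by eventually_elim (auto simp: dist_real_def blinfun.minus_right)
  qed
qed

text \<open>Under strong convergence the growth bound makes \<open>A (v n) (v n - u)\<close> vanish,
  so the limsup condition holds. This gives the continuity required on finite-dimensional
  spans.\<close>

lemma pseudomonotone_demicontinuous:
  assumes pm: "pseudomonotone A" and bound: "\<And>v. norm (A v) \<le> a + b * norm v" and b: "0 \<le> b" and v: "v \<longlonglongrightarrow> u"
  shows "(\<lambda>n. A (v n) w) \<longlonglongrightarrow> A u w"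
proof (rule pseudomonotone_weak_limit[OF pm tendsto_weakly_convergent[OF v]])
  fix e :: real assume e: "0 < e"
  have "(\<lambda>n. (a + b * norm (v n)) * norm (v n - u)) \<longlonglongrightarrow> (a + b * norm u) * norm (u - u)"
    by (intro tendsto_intros v)
  then have "\<forall>\<^sub>F n in sequentially. (a + b * norm (v n)) * norm (v n - u) < e"
    using e by (intro order_tendstoD) auto
  then show "\<forall>\<^sub>F n in sequentially. A (v n) (v n - u) \<le> e"
  proof eventually_elim
    case (elim n)
    have "\<bar>A (v n) (v n - u)\<bar> \<le> (a + b * norm (v n)) * norm (v n - u)"
      using norm_blinfun[of "A (v n)" "v n - u"] mult_right_mono[OF bound[of "v n"], of "norm (v n - u)"] by simp
    then show ?case using elim by linarith
  qed
qed

section \<open>Limits of bounded functionals\<close>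

text \<open>The uniform norm bound makes the error of replacing \<open>w\<close> by a point of
  \<open>D\<close> small for all \<open>n\<close> at once. It carries vanishing Galerkin residuals
  over to every test vector.\<close>

lemma tendsto_zero_dense:
  fixes L :: "nat \<Rightarrow> 'v::real_normed_vector \<Rightarrow>\<^sub>L real"
  assumes bdd: "\<And>n. norm (L n) \<le> M" and dense: "closure D = UNIV"
    and lim: "\<And>x. x \<in> D \<Longrightarrow> (\<lambda>n. L n x) \<longlonglongrightarrow> 0"
  shows "(\<lambda>n. L n w) \<longlonglongrightarrow> 0"
proof (rule tendstoI)
  fix e :: real assume e: "0 < e"
  have M: "0 \<le> M" using bdd[of 0] norm_ge_zero order_trans by blast
  obtain x where x: "x \<in> D" "dist x w < e / (2 * (M + 1))"
    using dense e M unfolding set_eq_iff closure_approachable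
    by (metis UNIV_I add_nonneg_pos divide_pos_pos mult_pos_pos zero_less_numeral zero_less_one)
  have small: "\<bar>L n (w - x)\<bar> < e / 2" for n
  proof -
    have "\<bar>L n (w - x)\<bar> \<le> M * norm (w - x)"
      using norm_blinfun[of "L n" "w - x"] mult_right_mono[OF bdd[of n], of "norm (w - x)"] by simp
    also have "\<dots> \<le> (M + 1) * norm (w - x)" by (simp add: mult_right_mono)
    also have "\<dots> < e / 2" using x(2) M by (simp add: dist_norm norm_minus_commute field_simps)
    finally show ?thesis .
  qed
  have "\<forall>\<^sub>F n in sequentially. dist (L n x) 0 < e / 2" using lim[OF x(1)] e by (intro tendstoD) auto
  then show "\<forall>\<^sub>F n in sequentially. dist (L n w) 0 < e"
  proof eventually_elim
    case (elim n)
    then show ?case using small[of n] unfolding dist_real_def blinfun.diff_right by linarith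
  qed
qed

text \<open>A Banach limit in place of weak-star sequential compactness, which may fail here.\<close>

lemma cluster_functional:
  fixes t :: "nat \<Rightarrow> 'a::real_normed_vector \<Rightarrow>\<^sub>L real"
  assumes bdd: "\<And>n. norm (t n) \<le> M"
  obtains \<xi> :: "'a \<Rightarrow>\<^sub>L real" where "\<forall>x r. (\<forall>\<^sub>F n in sequentially. t n x \<le> r) \<longrightarrow> \<xi> x \<le> r"
proof -
  define S where "S x = {r. \<forall>\<^sub>F n in sequentially. t n x \<le> r}" for x
  \<comment> \<open>This is the limsup of \<open>t n x\<close>, finite because the norms are
    bounded; every linear minorant respects eventual upper bounds.\<close>
  define p where "p x = Inf (S x)" for x
  have t: "\<bar>t n x\<bar> \<le> M * norm x" for n x
    using norm_blinfun[of "t n" x] mult_right_mono[OF bdd[of n], of "norm x"] by simp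
  have MS: "M * norm x \<in> S x" for x using t[of _ x] by (auto simp: S_def abs_le_iff)
  have S_ge: "- (M * norm x) \<le> r" if "r \<in> S x" for r x
  proof -
    have "\<forall>\<^sub>F n in sequentially. - (M * norm x) \<le> r"
      using that[unfolded S_def mem_Collect_eq] by eventually_elim (use t[of _ x] in \<open>smt (verit)\<close>)
    then show ?thesis by simp
  qed
  then have bdd': "bdd_below (S x)" for x by (intro bdd_belowI) auto
  have p_le: "p x \<le> r" if "r \<in> S x" for r x unfolding p_def by (rule cInf_lower[OF that bdd'])
  have p_ge: "c \<le> p x" if "\<And>r. r \<in> S x \<Longrightarrow> c \<le> r" for c x
    unfolding p_def using MS[of x] that by (intro cInf_greatest) auto
  have "sublinear p"
  proof (rule sublinearI)
    fix x y
    have add: "r + q \<in> S (x + y)" if "r \<in> S x" "q \<in> S y" for r q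
      using that unfolding S_def mem_Collect_eq blinfun.add_right
      by eventually_elim (rule add_mono)
    have "p (x + y) - r \<le> p y" if "r \<in> S x" for r
      by (rule p_ge) (use p_le[OF add[OF that]] in \<open>smt (verit)\<close>)
    then have "p (x + y) - p y \<le> p x" by (intro p_ge) (smt (verit))
    then show "p (x + y) \<le> p x + p y" by simp
  next
    fix c :: real and x assume c: "0 < c"
    have "p (c *\<^sub>R x) / c \<le> p x"
    proof (rule p_ge)
      fix r assume "r \<in> S x"
      then have "c * r \<in> S (c *\<^sub>R x)" using c by (simp add: S_def blinfun.scaleR_right)
      from p_le[OF this] show "p (c *\<^sub>R x) / c \<le> r" using c by (simp add: field_simps)
    qed
    then show "p (c *\<^sub>R x) \<le> c * p x" using c by (simp add: field_simps)
  next
    have "p 0 \<le> 0" using p_le[OF MS[of 0]] by simp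
    moreover have "0 \<le> p 0" by (rule p_ge) (use S_ge[of _ 0] in simp)
    ultimately show "p 0 = 0" by simp
  qed
  moreover have "p x \<le> M * norm x" for x by (rule p_le[OF MS])
  ultimately obtain \<xi> :: "'a \<Rightarrow>\<^sub>L real" where \<xi>: "\<And>x. \<xi> x \<le> p x"
    using sublinear_dominates_blinfun by blast
  show thesis
  proof (rule that[of \<xi>], intro allI impI)
    fix x r assume "\<forall>\<^sub>F n in sequentially. t n x \<le> r"
    then have "p x \<le> r" by (intro p_le) (simp add: S_def)
    with \<xi>[of x] show "\<xi> x \<le> r" by simp
  qed
qed

section \<open>The stationary inclusion\<close>

text \<open>The setting of a single time level. The intermediate space is present only through
  \<open>interpolation\<close>, which Ehrling's inequality supplies.\<close>

locale hemivariational_inclusion =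
  fixes i :: "'v::real_normed_vector \<Rightarrow>\<^sub>L 'h::real_inner"
    and \<iota> :: "'v \<Rightarrow>\<^sub>L 'u::real_normed_vector"
    and A :: "'v \<Rightarrow> 'v \<Rightarrow>\<^sub>L real"
    and J :: "'u \<Rightarrow> real"
    and a b \<alpha> \<beta> d :: real
  assumes refl: "reflexive_space TYPE('v)" and i_compact: "compact_map i"
    and H_dense: "\<And>g :: 'v \<Rightarrow>\<^sub>L real. \<And>e. 0 < e \<Longrightarrow> \<exists>h. \<forall>v. \<bar>g v - inner h (i v)\<bar> \<le> e * norm v"
    and A_pm: "pseudomonotone A" and b_nonneg: "0 \<le> b"
    and A_bound: "norm (A v) \<le> a + b * norm v"
    and \<alpha>_pos: "0 < \<alpha>"
    and A_coercive: "\<alpha> * (norm v)\<^sup>2 - \<beta> * (norm (i v))\<^sup>2 \<le> A v v"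
    and J_lipschitz: "locally_lipschitz J" and d_pos: "0 < d"
    and J_growth: "\<xi> \<in> clarke_subdiff J x \<Longrightarrow> norm \<xi> \<le> d * (1 + norm x)"
    and interpolation: "0 < \<epsilon> \<Longrightarrow> \<exists>C\<ge>0. \<forall>v. norm (\<iota> v) \<le> \<epsilon> * norm v + C * norm (i v)"
begin

text \<open>The first term is the embedding of \<open>u\<close> into the dual by way of the Hilbert
  space, and \<open>s o\<^sub>L \<iota>\<close> is the adjoint of \<open>\<iota>\<close> applied to
  \<open>s\<close>. Here \<open>s\<close> is any functional, so that approximate subgradients are
  covered.\<close>

definition residual :: "real \<Rightarrow> ('v \<Rightarrow>\<^sub>L real) \<Rightarrow> 'v \<Rightarrow> ('u \<Rightarrow>\<^sub>L real) \<Rightarrow> 'v \<Rightarrow>\<^sub>L real" where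
  "residual c g u s = c *\<^sub>R (blinfun_inner_right (i u) o\<^sub>L i) + A u + (s o\<^sub>L \<iota>) - g"

lemma residual_apply: "residual c g u s w = c * inner (i u) (i w) + A u w + s (\<iota> w) - g w"
  by (simp add: residual_def blinfun.bilinear_simps)

section \<open>Coercivity and finite-dimensional approximation\<close>

text \<open>The growth bound has \<open>2\<close> in place of \<open>1\<close> to admit subgradients
  taken at points within distance one. The threshold \<open>c0\<close> is independent of
  \<open>g\<close>.\<close>

lemma coercive:
  obtains c0 where "0 < c0"
    and "\<And>c g u s. c0 \<le> c \<Longrightarrow> norm s \<le> d * (2 + norm (\<iota> u)) \<Longrightarrow>
           \<alpha> / 4 * (norm u)\<^sup>2 - ((norm g)\<^sup>2 / \<alpha> + d) \<le> residual c g u s u"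
proof -
  \<comment> \<open>Chosen so that the subgradient term consumes \<open>\<alpha> / 2\<close> of the
    leading coefficient. Young's inequality for \<open>g\<close> takes another
    \<open>\<alpha> / 4\<close>, and \<open>\<alpha> / 4\<close> is left.\<close>
  define \<epsilon> where "\<epsilon> = sqrt (\<alpha> / (8 * d))"
  have \<epsilon>: "0 < \<epsilon>" "\<epsilon>\<^sup>2 = \<alpha> / (8 * d)" using \<alpha>_pos d_pos by (auto simp: \<epsilon>_def)
  obtain C where C: "0 \<le> C" "\<And>v. norm (\<iota> v) \<le> \<epsilon> * norm v + C * norm (i v)"
    using interpolation[OF \<epsilon>(1)] by blast
  \<comment> \<open>Large enough for \<open>c\<close> to absorb the Hilbert-space terms from
    \<open>A_coercive\<close> and from interpolation.\<close>
  define c0 where "c0 = \<bar>\<beta>\<bar> + 4 * d * C\<^sup>2 + 1"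
  show thesis
  proof (rule that[of c0])
    show "0 < c0" using d_pos by (simp add: c0_def add_nonneg_pos)
    fix c u and g :: "'v \<Rightarrow>\<^sub>L real" and s :: "'u \<Rightarrow>\<^sub>L real"
    assume c: "c0 \<le> c" and s: "norm s \<le> d * (2 + norm (\<iota> u))"
    let ?x = "norm u" and ?y = "norm (i u)" and ?z = "norm (\<iota> u)"
    have "?z\<^sup>2 \<le> (\<epsilon> * ?x + C * ?y)\<^sup>2" using C(2)[of u] by (simp add: power_mono)
    also have "\<dots> \<le> 2 * (\<epsilon> * ?x)\<^sup>2 + 2 * (C * ?y)\<^sup>2"
      using zero_le_power2[of "\<epsilon> * ?x - C * ?y"] unfolding power2_sum power2_diff by linarith
    finally have "2 * d * ?z\<^sup>2 \<le> 2 * d * (2 * (\<epsilon>\<^sup>2 * ?x\<^sup>2) + 2 * (C\<^sup>2 * ?y\<^sup>2))"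
      using d_pos by (simp add: power_mult_distrib)
    also have "\<dots> = \<alpha> / 2 * ?x\<^sup>2 + 4 * d * C\<^sup>2 * ?y\<^sup>2" using d_pos by (simp add: \<epsilon>(2) field_simps)
    finally have z: "2 * d * ?z\<^sup>2 \<le> \<alpha> / 2 * ?x\<^sup>2 + 4 * d * C\<^sup>2 * ?y\<^sup>2" .
    have "\<bar>s (\<iota> u)\<bar> \<le> d * (2 + ?z) * ?z"
      using norm_blinfun[of s "\<iota> u"] mult_right_mono[OF s, of ?z] by simp
    also have "\<dots> \<le> d * (1 + 2 * ?z\<^sup>2)"
    proof -
      have "(2 + ?z) * ?z \<le> 1 + 2 * ?z\<^sup>2"
        using zero_le_power2[of "?z - 1"] by (simp add: power2_eq_square algebra_simps)
      then show ?thesis using d_pos by (simp add: mult.assoc)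
    qed
    finally have su: "\<bar>s (\<iota> u)\<bar> \<le> d + 2 * d * ?z\<^sup>2" by (simp add: algebra_simps)
    have "0 \<le> (\<alpha> / 2 * ?x - norm g)\<^sup>2 / \<alpha>" using \<alpha>_pos by simp
    also have "\<dots> = \<alpha> / 4 * ?x\<^sup>2 - norm g * ?x + (norm g)\<^sup>2 / \<alpha>"
      using \<alpha>_pos by (simp add: power2_eq_square field_simps)
    finally have gu: "g u \<le> \<alpha> / 4 * ?x\<^sup>2 + (norm g)\<^sup>2 / \<alpha>"
      using norm_blinfun[of g u] by simp
    have "(\<beta> + 4 * d * C\<^sup>2) * ?y\<^sup>2 \<le> c * ?y\<^sup>2"
      using c by (intro mult_right_mono) (auto simp: c0_def)
    then have "(\<beta> + 4 * d * C\<^sup>2) * ?y\<^sup>2 \<le> c * inner (i u) (i u)" by (simp add: power2_norm_eq_inner)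
    then show "\<alpha> / 4 * ?x\<^sup>2 - ((norm g)\<^sup>2 / \<alpha> + d) \<le> residual c g u s u"
      using z su gu A_coercive[of u] unfolding residual_apply by (simp add: algebra_simps)
  qed
qed

text \<open>Points of the ball have norm at most \<open>1 + norm x\<close>, so the growth condition
  puts their subgradients in one closed ball, which is convex.\<close>

lemma hull_clarke_subdiff_bound:
  assumes "s \<in> convex hull (\<Union>y\<in>ball x \<delta>. clarke_subdiff J y)" and "\<delta> \<le> 1"
  shows "norm s \<le> d * (2 + norm x)"
proof -
  have "clarke_subdiff J y \<subseteq> cball 0 (d * (2 + norm x))" if "y \<in> ball x \<delta>" for y
  proof
    fix \<xi> assume "\<xi> \<in> clarke_subdiff J y"
    then have "norm \<xi> \<le> d * (1 + norm y)" by (rule J_growth)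
    also have "\<dots> \<le> d * (2 + norm x)"
      using that assms(2) d_pos norm_triangle_sub[of y x] by (simp add: dist_norm norm_minus_commute)
    finally show "\<xi> \<in> cball 0 (d * (2 + norm x))" by simp
  qed
  then have "convex hull (\<Union>y\<in>ball x \<delta>. clarke_subdiff J y) \<subseteq> cball 0 (d * (2 + norm x))"
    by (intro hull_minimal convex_cball) blast
  with assms(1) show ?thesis by auto
qed

text \<open>The vectors \<open>e k\<close> need not be linearly independent: the extra term \<open>\<delta> x\<close> makes the
  problem coercive in the coefficients, at the price of a small residual.\<close>

lemma galerkin_approximation:
  fixes e :: "nat \<Rightarrow> 'v"
  assumes coer: "\<And>u s. norm s \<le> d * (2 + norm (\<iota> u)) \<Longrightarrow> \<alpha> / 4 * (norm u)\<^sup>2 - K \<le> residual c g u s u"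
    and K: "0 \<le> K" and \<delta>: "0 < \<delta>" "\<delta> \<le> 1"
  obtains u s where "s \<in> convex hull (\<Union>y\<in>ball (\<iota> u) \<delta>. clarke_subdiff J y)"
    and "\<And>k. k < n \<Longrightarrow> (residual c g u s (e k))\<^sup>2 \<le> \<delta> * K"
    and "residual c g u s u \<le> 0" and "\<alpha> / 4 * (norm u)\<^sup>2 \<le> K"
proof -
  \<comment> \<open>With \<open>R\<^sup>2 > K / \<delta>\<close> the a priori bound
    \<open>\<delta> * (x k)\<^sup>2 \<le> K\<close> keeps the first \<open>n\<close> coefficients
    strictly inside the cube.\<close>
  define R where "R = sqrt (K / \<delta>) + 1"
  have R: "0 < R" "K / \<delta> < R\<^sup>2"
  proof -
    have 0: "0 \<le> sqrt (K / \<delta>)" using K \<delta> by simp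
    then show "0 < R" unfolding R_def by linarith
    have "K / \<delta> = (sqrt (K / \<delta>))\<^sup>2" using K \<delta> by simp
    also have "\<dots> < R\<^sup>2" unfolding R_def using 0 by (intro power_strict_mono) auto
    finally show "K / \<delta> < R\<^sup>2" .
  qed
  define Q where "Q = {x :: nat \<Rightarrow> real. \<forall>j. \<bar>x j\<bar> \<le> R}"
  define comb where "comb x = (\<Sum>k<n. x k *\<^sub>R e k)" for x
  have cont_comb: "continuous_on Q comb"
    unfolding comb_def
    by (intro continuous_on_sum continuous_on_scaleR continuous_on_const
        continuous_on_subset[OF continuous_on_product_coordinates]) simp
  then have cont_\<iota>: "continuous_on Q (\<lambda>x. \<iota> (comb x))" by (intro continuous_intros)
  have "compact Q" unfolding Q_def by (rule compact_cube)
  then have "compact ((\<lambda>x. \<iota> (comb x)) ` Q)" by (rule compact_continuous_image[OF cont_\<iota>])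
  then obtain S where cont_S: "continuous_on ((\<lambda>x. \<iota> (comb x)) ` Q) S"
    and S: "\<And>z. z \<in> (\<lambda>x. \<iota> (comb x)) ` Q \<Longrightarrow> S z \<in> convex hull (\<Union>y\<in>ball z \<delta>. clarke_subdiff J y)"
    using approximate_continuous_selection[OF _ _ \<delta>(1), of _ "clarke_subdiff J"]
      clarke_subdiff_nonempty[OF J_lipschitz] by (metis empty_iff)
  define G where "G k x = residual c g (comb x) (S (\<iota> (comb x))) (e k) + \<delta> * x k" for k x
  have cont_A: "continuous_on Q (\<lambda>x. A (comb x) w)" for w
    unfolding continuous_on_sequentially
  proof (intro allI ballI impI)
    fix X x assume "x \<in> Q" and "(\<forall>n. X n \<in> Q) \<and> X \<longlonglongrightarrow> x"
    then have "(\<lambda>m. comb (X m)) \<longlonglongrightarrow> comb x"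
      using cont_comb unfolding continuous_on_sequentially by (simp add: o_def)
    from pseudomonotone_demicontinuous[OF A_pm A_bound b_nonneg this]
    show "((\<lambda>x. A (comb x) w) \<circ> X) \<longlonglongrightarrow> A (comb x) w" by (simp add: o_def)
  qed
  have cont_S': "continuous_on Q (\<lambda>x. S (\<iota> (comb x)))"
    using continuous_on_compose[OF cont_\<iota> cont_S] by (simp add: o_def)
  have "continuous_on Q (G k)" for k
    unfolding G_def residual_apply
    by (intro continuous_intros cont_A cont_comb cont_S' blinfun.continuous_on
        continuous_on_subset[OF continuous_on_product_coordinates]) simp_all
  then obtain x where x: "\<forall>j. \<bar>x j\<bar> \<le> R" and vi: "\<And>k t. k < n \<Longrightarrow> \<bar>t\<bar> \<le> R \<Longrightarrow> 0 \<le> G k x * (t - x k)"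
    using cube_variational_inequality[OF R(1), of n G] unfolding Q_def by blast
  define u s where "u = comb x" and "s = S (\<iota> u)"
  have s: "s \<in> convex hull (\<Union>y\<in>ball (\<iota> u) \<delta>. clarke_subdiff J y)"
    unfolding s_def u_def using x by (intro S) (auto simp: Q_def)
  have G: "G k x = residual c g u s (e k) + \<delta> * x k" for k by (simp add: G_def u_def s_def)
  have comb: "L u = (\<Sum>k<n. L (e k) * x k)" for L :: "'v \<Rightarrow>\<^sub>L real"
    by (simp add: u_def comb_def blinfun.sum_right blinfun.scaleR_right mult.commute)
  \<comment> \<open>Taking \<open>t = 0\<close> in each coordinate and summing tests the residual
    with \<open>u\<close> itself.\<close>
  have "residual c g u s u + \<delta> * (\<Sum>k<n. (x k)\<^sup>2) = (\<Sum>k<n. G k x * x k)"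
    unfolding comb[of "residual c g u s"] G
    by (simp add: sum_distrib_left distrib_right sum.distrib power2_eq_square mult.assoc)
  also have "\<dots> \<le> 0" using vi[of _ 0] R(1) by (intro sum_nonpos) auto
  finally have energy: "residual c g u s u + \<delta> * (\<Sum>k<n. (x k)\<^sup>2) \<le> 0" .
  have low: "\<alpha> / 4 * (norm u)\<^sup>2 - K \<le> residual c g u s u"
    by (rule coer[OF hull_clarke_subdiff_bound[OF s \<delta>(2)]])
  have sum_nonneg: "0 \<le> \<delta> * (\<Sum>k<n. (x k)\<^sup>2)" using \<delta> by (simp add: sum_nonneg)
  have xk: "\<delta> * (x k)\<^sup>2 \<le> K" if "k < n" for k
  proof -
    have "\<delta> * (x k)\<^sup>2 \<le> \<delta> * (\<Sum>k<n. (x k)\<^sup>2)"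
      using \<delta> that by (intro mult_left_mono member_le_sum) auto
    moreover have "0 \<le> \<alpha> / 4 * (norm u)\<^sup>2" using \<alpha>_pos by simp
    ultimately show ?thesis using energy low by linarith
  qed
  have res: "(residual c g u s (e k))\<^sup>2 \<le> \<delta> * K" if k: "k < n" for k
  proof -
    have "\<delta> * (x k)\<^sup>2 < \<delta> * R\<^sup>2"
      using xk[OF k] R(2) \<delta> by (intro le_less_trans[OF xk[OF k]]) (simp add: field_simps)
    then have "\<bar>x k\<bar>\<^sup>2 < R\<^sup>2" using \<delta> by simp
    then have "\<bar>x k\<bar> < R" by (rule power2_less_imp_less) (use R(1) in simp)
    then have "0 < R - x k" "- R - x k < 0" by (auto simp: abs_less_iff)
    \<comment> \<open>At an interior coordinate both \<open>t = R\<close> and \<open>t = - R\<close>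
      are strict moves in opposite directions, so the inequality becomes an equation.\<close>
    then have "G k x = 0"
      using vi[OF k, of R] vi[OF k, of "- R"] R(1) by (auto simp: zero_le_mult_iff)
    then have "residual c g u s (e k) = - (\<delta> * x k)" by (simp add: G)
    then have "(residual c g u s (e k))\<^sup>2 = \<delta> * (\<delta> * (x k)\<^sup>2)" by (simp add: power2_eq_square)
    then show ?thesis using xk[OF k] \<delta> by simp
  qed
  show thesis
    by (rule that[OF s res]) (use energy low sum_nonneg in auto)
qed

section \<open>Passage to the limit\<close>

text \<open>The Galerkin bounds depend only on \<open>K\<close>, so they are uniform in the number
  of test vectors and in \<open>\<delta>\<close>, and a weak limit exists.\<close>

lemma solution_exists:
  fixes e :: "nat \<Rightarrow> 'v"
  assumes dense: "closure (range e) = UNIV"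
    and coer: "\<And>u s. norm s \<le> d * (2 + norm (\<iota> u)) \<Longrightarrow> \<alpha> / 4 * (norm u)\<^sup>2 - K \<le> residual c g u s u"
    and K: "0 \<le> K"
  obtains u \<xi> where "\<xi> \<in> clarke_subdiff J (\<iota> u)" and "residual c g u \<xi> = 0"
proof -
  \<comment> \<open>One null sequence controls both the radius of the selection and the
    regularisation; the index \<open>n\<close> also counts the test vectors.\<close>
  define \<delta> where "\<delta> n = 1 / real (Suc n)" for n
  have \<delta>: "0 < \<delta> n" "\<delta> n \<le> 1" for n by (auto simp: \<delta>_def)
  have \<delta>_lim: "\<delta> \<longlonglongrightarrow> 0" unfolding \<delta>_def by (rule LIMSEQ_Suc[OF lim_1_over_n])
  have "\<exists>u s. s \<in> convex hull (\<Union>y\<in>ball (\<iota> u) (\<delta> n). clarke_subdiff J y)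
      \<and> (\<forall>k<n. (residual c g u s (e k))\<^sup>2 \<le> \<delta> n * K)
      \<and> residual c g u s u \<le> 0 \<and> \<alpha> / 4 * (norm u)\<^sup>2 \<le> K" for n
    using galerkin_approximation[OF coer K \<delta>, of n n e] by metis
  then obtain u s where hull: "\<And>n. s n \<in> convex hull (\<Union>y\<in>ball (\<iota> (u n)) (\<delta> n). clarke_subdiff J y)"
    and res: "\<And>n k. k < n \<Longrightarrow> (residual c g (u n) (s n) (e k))\<^sup>2 \<le> \<delta> n * K"
    and energy: "\<And>n. residual c g (u n) (s n) (u n) \<le> 0" and bound: "\<And>n. \<alpha> / 4 * (norm (u n))\<^sup>2 \<le> K"
    by metis
  define M where "M = sqrt (4 * K / \<alpha>)"
  have u_le: "norm (u n) \<le> M" for n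
    unfolding M_def using bound[of n] \<alpha>_pos by (intro real_le_rsqrt) (simp add: field_simps)
  have M: "0 \<le> M" using u_le[of 0] norm_ge_zero order_trans by blast
  define S where "S = d * (2 + norm \<iota> * M)"
  have s_le: "norm (s n) \<le> S" for n
  proof -
    have "norm (s n) \<le> d * (2 + norm (\<iota> (u n)))" by (rule hull_clarke_subdiff_bound[OF hull \<delta>(2)])
    also have "norm (\<iota> (u n)) \<le> norm \<iota> * M"
      using norm_blinfun[of \<iota> "u n"] mult_left_mono[OF u_le[of n], of "norm \<iota>"] by simp
    finally show ?thesis using d_pos by (simp add: S_def)
  qed
  obtain \<phi> v where \<phi>: "strict_mono (\<phi> :: nat \<Rightarrow> nat)" and weak: "weakly_convergent (\<lambda>n. u (\<phi> n)) v"
    and iv: "(\<lambda>n. i (u (\<phi> n))) \<longlonglongrightarrow> i v"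
    by (rule bounded_weakly_convergent_subseq[OF refl i_compact H_dense u_le])
  define w t where "w n = u (\<phi> n)" and "t n = s (\<phi> n)" for n
  note weak = weak[folded w_def] and iv = iv[folded w_def]
  have w_le: "norm (w n) \<le> M" and t_le: "norm (t n) \<le> S" for n
    by (auto simp: w_def t_def u_le s_le)
  have gw: "(\<lambda>n. blinfun_apply g (w n)) \<longlonglongrightarrow> g v" using weak by (simp add: weakly_convergent_def)
  \<comment> \<open>Interpolation turns boundedness in \<open>'v\<close> and strong convergence of
    the \<open>i (w n)\<close> into strong convergence of the \<open>\<iota> (w n)\<close>.\<close>
  have \<iota>v: "(\<lambda>n. \<iota> (w n)) \<longlonglongrightarrow> \<iota> v"
  proof (rule tendstoI)
    fix \<epsilon> :: real assume \<epsilon>: "0 < \<epsilon>"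
    define D where "D = M + norm v + 1"
    define \<eta> where "\<eta> = \<epsilon> / (4 * D)"
    have D: "0 < D" "M + norm v \<le> D" using M by (auto simp: D_def add_nonneg_pos)
    have \<eta>: "0 < \<eta>" "\<eta> * (M + norm v) < \<epsilon> / 2"
    proof -
      show "0 < \<eta>" using \<epsilon> D by (simp add: \<eta>_def)
      then have "\<eta> * (M + norm v) \<le> \<eta> * D" using D by simp
      also have "\<dots> = \<epsilon> / 4" using D by (simp add: \<eta>_def)
      finally show "\<eta> * (M + norm v) < \<epsilon> / 2" using \<epsilon> by simp
    qed
    obtain C where C: "0 \<le> C" "\<And>v. norm (\<iota> v) \<le> \<eta> * norm v + C * norm (i v)"
      using interpolation[OF \<eta>(1)] by blast
    have "(\<lambda>n. C * norm (i (w n) - i v)) \<longlonglongrightarrow> C * norm (i v - i v)" by (intro tendsto_intros iv)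
    then have "\<forall>\<^sub>F n in sequentially. C * norm (i (w n) - i v) < \<epsilon> / 2"
      using \<epsilon> by (intro order_tendstoD) auto
    then show "\<forall>\<^sub>F n in sequentially. dist (\<iota> (w n)) (\<iota> v) < \<epsilon>"
    proof eventually_elim
      case (elim n)
      have "\<eta> * norm (w n - v) \<le> \<eta> * (M + norm v)"
        using norm_triangle_ineq4[of "w n" v] w_le[of n] \<eta>(1) by (intro mult_left_mono) auto
      then show ?case
        using C(2)[of "w n - v"] elim \<eta>(2) unfolding dist_norm blinfun.diff_right by linarith
    qed
  qed
  define B where "B n = residual c g (w n) (t n)" for n
  have B_bound: "norm (B n) \<le> \<bar>c\<bar> * (norm i * M * norm i) + (a + b * M) + S * norm \<iota> + norm g" for n
  proof -
    have "norm (blinfun_inner_right (i (w n)) o\<^sub>L i) \<le> norm (blinfun_inner_right (i (w n))) * norm i"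
      by (rule norm_blinfun_compose)
    also have "norm (blinfun_inner_right (i (w n))) \<le> norm (i (w n))"
      by (rule norm_blinfun_bound) (auto simp: Cauchy_Schwarz_ineq2)
    also have "norm (i (w n)) \<le> norm i * M"
      using norm_blinfun[of i "w n"] mult_left_mono[OF w_le[of n], of "norm i"] by simp
    finally have 1: "norm (blinfun_inner_right (i (w n)) o\<^sub>L i) \<le> norm i * M * norm i"
      by (simp add: mult_right_mono)
    have 2: "norm (A (w n)) \<le> a + b * M"
      using A_bound[of "w n"] mult_left_mono[OF w_le[of n] b_nonneg] by simp
    have 3: "norm (t n o\<^sub>L \<iota>) \<le> S * norm \<iota>"
      using norm_blinfun_compose[of "t n" \<iota>] mult_right_mono[OF t_le[of n], of "norm \<iota>"] by simp
    have "norm (c *\<^sub>R (blinfun_inner_right (i (w n)) o\<^sub>L i)) \<le> \<bar>c\<bar> * (norm i * M * norm i)"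
      using 1 by (simp add: mult_left_mono)
    then show ?thesis
      unfolding B_def residual_def using 2 3
      by (intro order_trans[OF norm_triangle_ineq4] order_trans[OF norm_triangle_ineq] add_mono order_refl)
  qed
  have B_e: "(\<lambda>n. B n (e k)) \<longlonglongrightarrow> 0" for k
  proof -
    have "(\<lambda>n. (residual c g (u n) (s n) (e k))\<^sup>2) \<longlonglongrightarrow> 0"
    proof (rule Lim_null_comparison)
      show "\<forall>\<^sub>F n in sequentially. norm ((residual c g (u n) (s n) (e k))\<^sup>2) \<le> \<delta> n * K"
        using eventually_gt_at_top[of k] by eventually_elim (simp add: res)
      show "(\<lambda>n. \<delta> n * K) \<longlonglongrightarrow> 0" by (rule tendsto_mult_left_zero[OF \<delta>_lim])
    qed
    then have "(\<lambda>n. residual c g (u n) (s n) (e k)) \<longlonglongrightarrow> 0" by simp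
    from LIMSEQ_subseq_LIMSEQ[OF this \<phi>] show ?thesis by (simp add: o_def B_def w_def t_def)
  qed
  have B_lim: "(\<lambda>n. B n x) \<longlonglongrightarrow> 0" for x
    by (rule tendsto_zero_dense[where L = B, OF B_bound dense]) (use B_e in blast)
  have B_apply: "B n x = c * inner (i (w n)) (i x) + A (w n) x + t n (\<iota> x) - g x" for n x
    by (simp add: B_def residual_apply)
  \<comment> \<open>Subtracting the residual at \<open>v\<close> from the energy inequality
    \<open>B n (w n) \<le> 0\<close> bounds \<open>A (w n) (w n - v)\<close> by terms that all tend
    to zero.\<close>
  have A_lim: "(\<lambda>n. A (w n) x) \<longlonglongrightarrow> A v x" for x
  proof (rule pseudomonotone_weak_limit[OF A_pm weak])
    fix \<epsilon> :: real assume \<epsilon>: "0 < \<epsilon>"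
    have "(\<lambda>n. \<bar>c * inner (i (w n)) (i (w n) - i v)\<bar>) \<longlonglongrightarrow> \<bar>c * inner (i v) (i v - i v)\<bar>"
      by (intro tendsto_intros iv)
    moreover have "(\<lambda>n. S * norm (\<iota> (w n) - \<iota> v)) \<longlonglongrightarrow> S * norm (\<iota> v - \<iota> v)"
      by (intro tendsto_intros \<iota>v)
    moreover have "(\<lambda>n. g (w n) - g v) \<longlonglongrightarrow> g v - g v" by (intro tendsto_intros gw)
    ultimately have "(\<lambda>n. - B n v + \<bar>c * inner (i (w n)) (i (w n) - i v)\<bar>
        + S * norm (\<iota> (w n) - \<iota> v) + (g (w n) - g v)) \<longlonglongrightarrow> - 0 + 0 + 0 + 0"
      by (intro tendsto_add tendsto_minus B_lim) auto
    then have "\<forall>\<^sub>F n in sequentially. - B n v + \<bar>c * inner (i (w n)) (i (w n) - i v)\<bar>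
        + S * norm (\<iota> (w n) - \<iota> v) + (g (w n) - g v) < \<epsilon>"
      using \<epsilon> by (intro order_tendstoD) auto
    then show "\<forall>\<^sub>F n in sequentially. A (w n) (w n - v) \<le> \<epsilon>"
    proof eventually_elim
      case (elim n)
      have "\<bar>t n (\<iota> (w n) - \<iota> v)\<bar> \<le> S * norm (\<iota> (w n) - \<iota> v)"
        using norm_blinfun[of "t n" "\<iota> (w n) - \<iota> v"] mult_right_mono[OF t_le[of n], of "norm (\<iota> (w n) - \<iota> v)"]
        by simp
      moreover have "B n (w n) \<le> 0" using energy by (simp add: B_def w_def t_def)
      moreover have "B n (w n) - B n v = c * inner (i (w n)) (i (w n) - i v) + A (w n) (w n - v)
          + t n (\<iota> (w n) - \<iota> v) - (g (w n) - g v)"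
        unfolding B_apply by (simp add: blinfun.diff_right inner_diff_right algebra_simps)
      ultimately show ?case using elim by linarith
    qed
  qed
  obtain \<xi> :: "'u \<Rightarrow>\<^sub>L real" where "\<forall>x r. (\<forall>\<^sub>F n in sequentially. t n x \<le> r) \<longrightarrow> \<xi> x \<le> r"
    by (rule cluster_functional[where t = t, OF t_le])
  note \<xi> = this[rule_format]
  \<comment> \<open>Eventual bounds for both \<open>x\<close> and \<open>- x\<close> force
    \<open>\<xi>\<close> to agree with the limit wherever it exists.\<close>
  have \<xi>_lim: "\<xi> x = l" if lim: "(\<lambda>n. t n x) \<longlonglongrightarrow> l" for x l
  proof (rule antisym; rule field_le_epsilon)
    fix \<epsilon> :: real assume \<epsilon>: "0 < \<epsilon>"
    have "\<forall>\<^sub>F n in sequentially. t n x < l + \<epsilon>" "\<forall>\<^sub>F n in sequentially. l - \<epsilon> < t n x"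
      using order_tendstoD[OF lim] \<epsilon> by auto
    then have "\<forall>\<^sub>F n in sequentially. t n x \<le> l + \<epsilon>" "\<forall>\<^sub>F n in sequentially. t n (- x) \<le> \<epsilon> - l"
      by (auto elim: eventually_mono simp: blinfun.minus_right)
    from this[THEN \<xi>] show "\<xi> x \<le> l + \<epsilon>" "l \<le> \<xi> x + \<epsilon>" by (auto simp: blinfun.minus_right)
  qed
  show thesis
  proof (rule that[of \<xi> v])
    \<comment> \<open>All other terms of the residual converge, hence so does
      \<open>t n (\<iota> x)\<close>, and its limit is the value of \<open>\<xi>\<close>.\<close>
    have "residual c g v \<xi> x = 0" for x
    proof -
      have "(\<lambda>n. B n x - c * inner (i (w n)) (i x) - A (w n) x + g x)
          \<longlonglongrightarrow> 0 - c * inner (i v) (i x) - A v x + g x"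
        by (intro tendsto_intros B_lim iv A_lim)
      then have "(\<lambda>n. t n (\<iota> x)) \<longlonglongrightarrow> g x - c * inner (i v) (i x) - A v x"
        by (simp add: B_apply algebra_simps)
      then show ?thesis using \<xi>_lim by (simp add: residual_apply)
    qed
    then show "residual c g v \<xi> = 0" by (intro blinfun_eqI) simp
    have "ereal (\<xi> x) \<le> clarke_dd J (\<iota> v) x" for x
    proof (rule ccontr)
      assume "\<not> ?thesis"
      then have "clarke_dd J (\<iota> v) x < ereal (\<xi> x)" by (simp only: not_le)
      from ereal_dense2[OF this] obtain r where r: "clarke_dd J (\<iota> v) x < ereal r" "r < \<xi> x"
        by auto
      obtain \<rho> where \<rho>: "0 < \<rho>"
        and usc: "\<forall>z \<zeta>. dist z (\<iota> v) < \<rho> \<longrightarrow> \<zeta> \<in> clarke_subdiff J z \<longrightarrow> \<zeta> x \<le> r"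
        by (rule clarke_subdiff_upper_semicontinuous[OF r(1)])
      have "(\<lambda>n. \<delta> (\<phi> n)) \<longlonglongrightarrow> 0" using LIMSEQ_subseq_LIMSEQ[OF \<delta>_lim \<phi>] by (simp add: o_def)
      then have "\<forall>\<^sub>F n in sequentially. \<delta> (\<phi> n) < \<rho> / 2" using \<rho> by (intro order_tendstoD) auto
      moreover have "\<forall>\<^sub>F n in sequentially. dist (\<iota> (w n)) (\<iota> v) < \<rho> / 2" using \<rho> by (intro tendstoD \<iota>v) auto
      \<comment> \<open>Eventually the whole ball around \<open>\<iota> (w n)\<close> lies within
        \<open>\<rho>\<close> of \<open>\<iota> v\<close>. The half-space of functionals with value
        at most \<open>r\<close> at \<open>x\<close> is convex, so the bound extends to the hull
        containing \<open>t n\<close>.\<close>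
      ultimately have "\<forall>\<^sub>F n in sequentially. t n x \<le> r"
      proof eventually_elim
        case (elim n)
        have "convex {\<zeta> :: 'u \<Rightarrow>\<^sub>L real. \<zeta> x \<le> r}"
          by (rule convexI) (simp add: blinfun.bilinear_simps convex_bound_le)
        moreover have "dist y (\<iota> v) < \<rho>" if "y \<in> ball (\<iota> (w n)) (\<delta> (\<phi> n))" for y
          using that elim dist_triangle[of y "\<iota> v" "\<iota> (w n)"] by (simp add: dist_commute)
        ultimately have "convex hull (\<Union>y\<in>ball (\<iota> (w n)) (\<delta> (\<phi> n)). clarke_subdiff J y) \<subseteq> {\<zeta>. blinfun_apply \<zeta> x \<le> r}"
          using usc by (intro hull_minimal) blast+
        then show ?case using hull[of "\<phi> n"] by (auto simp: w_def t_def)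
      qed
      from \<xi>[OF this] r(2) show False by simp
    qed
    then show "\<xi> \<in> clarke_subdiff J (\<iota> v)" by (simp add: clarke_subdiff_def)
  qed
qed

end

section \<open>The two-step scheme\<close>

theorem theorem4p1:
  fixes i :: "'v::{banach, second_countable_topology} \<Rightarrow> 'h::{real_inner, complete_space, second_countable_topology}"
    and j1 :: "'v \<Rightarrow> 'z::banach" and jZ :: "'z \<Rightarrow> 'h"
    and \<iota> :: "'v \<Rightarrow> 'u::banach" and \<iota>2 :: "'z \<Rightarrow> 'u"
    and A :: "'v \<Rightarrow> ('v \<Rightarrow>\<^sub>L real)"
    and J :: "'u \<Rightarrow> real"
    and f :: "real \<Rightarrow> ('v \<Rightarrow>\<^sub>L real)"
    and T a b \<alpha> \<beta> d :: real
    and u00 :: "nat \<Rightarrow> 'v"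
  assumes V_refl: "reflexive_space TYPE('v)"
    and U_refl: "reflexive_space TYPE('u)"
    and i_lin: "bounded_linear i" and i_inj: "inj i"
    and i_dense: "closure (range i) = UNIV"
    and i_compact: "compact_map i"
    and H_dense_in_Vstar: "\<forall>g :: 'v \<Rightarrow>\<^sub>L real. \<forall>e>0. \<exists>h::'h.
                             \<forall>v. \<bar>blinfun_apply g v - inner h (i v)\<bar> \<le> e * norm v"
    and T_pos: "T > 0"
    and A_pm: "pseudomonotone A"
    and a_nonneg: "a \<ge> 0" and b_pos: "b > 0"
    and A_bound: "\<forall>v. norm (A v) \<le> a + b * norm v"
    and \<alpha>_pos: "\<alpha> > 0" and \<beta>_nonneg: "\<beta> \<ge> 0"
    and A_coerc: "\<forall>v. blinfun_apply (A v) v \<ge> \<alpha> * (norm v)\<^sup>2 - \<beta> * (norm (i v))\<^sup>2"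
    and J_loclip: "locally_lipschitz J"
    and d_pos: "d > 0"
    and J_growth: "\<forall>u. \<forall>\<xi>\<in>clarke_subdiff J u. norm \<xi> \<le> d * (1 + norm u)"
    and \<iota>_lin: "bounded_linear \<iota>" and \<iota>_compact: "compact_map \<iota>"
    and j1_lin: "bounded_linear j1" and j1_inj: "inj j1" and j1_compact: "compact_map j1"
    and jZ_lin: "bounded_linear jZ" and jZ_inj: "inj jZ"
    and i_factor: "i = jZ \<circ> j1"
    and \<iota>2_lin: "bounded_linear \<iota>2"
    and \<iota>_factor: "\<iota> = \<iota>2 \<circ> j1"
    and f_L2: "L2_on 0 T f"
  shows "\<exists>\<tau>0>0. \<forall>N::nat. 0 < N \<and> T / real N < \<tau>0 \<longrightarrow>
           (let \<tau> = T / real N;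
                F = (\<lambda>n::nat. if n = 1 then (1 / \<tau>) *\<^sub>R integral {0..\<tau>} f
                     else (3 / (2 * \<tau>)) *\<^sub>R integral {(real n - 1) * \<tau>..real n * \<tau>} f
                          - (1 / (2 * \<tau>)) *\<^sub>R integral {(real n - 2) * \<tau>..(real n - 1) * \<tau>} f)
            in \<exists>u :: nat \<Rightarrow> 'v. \<exists>\<xi> :: nat \<Rightarrow> ('u \<Rightarrow>\<^sub>L real).
                 u 0 = u00 N \<and>
                 (\<forall>w. (1 / \<tau>) * inner (i (u 1 - u 0)) (i w) + blinfun_apply (A (u 1)) w
                        + blinfun_apply (\<xi> 1) (\<iota> w) = blinfun_apply (F 1) w) \<and>
                 \<xi> 1 \<in> clarke_subdiff J (\<iota> (u 1)) \<and>
                 (\<forall>n\<in>{2..N}.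
                    (\<forall>w. (1 / \<tau>) * inner (i ((3/2) *\<^sub>R u n - 2 *\<^sub>R u (n - 1) + (1/2) *\<^sub>R u (n - 2))) (i w)
                          + blinfun_apply (A (u n)) w + blinfun_apply (\<xi> n) (\<iota> w)
                          = blinfun_apply (F n) w) \<and>
                    \<xi> n \<in> clarke_subdiff J (\<iota> (u n))))"
proof -
  define I where "I = Blinfun i"
  define E where "E = Blinfun \<iota>"
  have I: "blinfun_apply I = i" and E: "blinfun_apply E = \<iota>"
    using i_lin \<iota>_lin by (simp_all add: I_def E_def bounded_linear_Blinfun_apply)
  interpret i: bounded_linear i by (rule i_lin)
  have interp: "\<exists>C\<ge>0. \<forall>v. norm (\<iota> v) \<le> \<epsilon> * norm v + C * norm (i v)" if \<epsilon>: "0 < \<epsilon>" for \<epsilon>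
  proof -
    obtain M where M: "0 < M" "\<And>z. norm (\<iota>2 z) \<le> norm z * M"
      using bounded_linear.pos_bounded[OF \<iota>2_lin] by blast
    \<comment> \<open>The factor \<open>M\<close> of the continuous map \<open>\<iota>2\<close> is
      compensated in advance by using \<open>\<epsilon> / M\<close>.\<close>
    obtain C where C: "0 \<le> C" "\<And>v. norm (j1 v) \<le> \<epsilon> / M * norm v + C * norm (jZ (j1 v))"
      using ehrling[OF j1_lin j1_compact jZ_lin jZ_inj, of "\<epsilon> / M"] \<epsilon> M(1) by auto
    have "norm (\<iota> v) \<le> \<epsilon> * norm v + (C * M) * norm (i v)" for v
    proof -
      have "norm (\<iota> v) \<le> norm (j1 v) * M" using M(2) by (simp add: \<iota>_factor)
      also have "\<dots> \<le> (\<epsilon> / M * norm v + C * norm (i v)) * M"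
        using C(2)[of v] M(1) by (simp add: i_factor)
      also have "\<dots> = \<epsilon> * norm v + (C * M) * norm (i v)" using M(1) by (simp add: field_simps)
      finally show ?thesis .
    qed
    then show ?thesis using C(1) M(1) by (intro exI[of _ "C * M"]) simp
  qed
  interpret hemivariational_inclusion I E A J a b \<alpha> \<beta> d
  proof
    show "\<exists>h. \<forall>v. \<bar>g v - inner h (I v)\<bar> \<le> e * norm v" if "0 < e" for g :: "'v \<Rightarrow>\<^sub>L real" and e
      using H_dense_in_Vstar that unfolding I by blast
    show "\<exists>C\<ge>0. \<forall>v. norm (E v) \<le> \<epsilon> * norm v + C * norm (I v)" if "0 < \<epsilon>" for \<epsilon>
      using interp[OF that] unfolding I E .
  qed (use V_refl i_compact A_pm b_pos A_bound \<alpha>_pos A_coerc J_loclip d_pos J_growth in \<open>auto simp: I\<close>)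
  \<comment> \<open>Separability: an enumeration of a countable dense set provides the Galerkin test
    vectors.\<close>
  obtain D :: "'v set" where D: "countable D" "\<And>X. open X \<Longrightarrow> X \<noteq> {} \<Longrightarrow> \<exists>x\<in>D. x \<in> X"
    using countable_dense_setE by blast
  have "D \<noteq> {}" using D(2)[of UNIV] by auto
  then have "range (from_nat_into D) = D" using D(1) by (rule range_from_nat_into)
  moreover have "closure D = UNIV"
    unfolding set_eq_iff closure_approachable using D(2)[OF open_ball] by (force simp: dist_commute)
  ultimately have dense: "closure (range (from_nat_into D)) = UNIV" by simp
  obtain c0 where c0: "0 < c0"
    and coer: "\<And>c g u s. c0 \<le> c \<Longrightarrow> norm s \<le> d * (2 + norm (E u)) \<Longrightarrow>
           \<alpha> / 4 * (norm u)\<^sup>2 - ((norm g)\<^sup>2 / \<alpha> + d) \<le> residual c g u s u"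
    using coercive by blast
  \<comment> \<open>The vector \<open>h\<close> carries the previous iterates to the right-hand
    side, and \<open>c0\<close> depends on neither \<open>g\<close> nor \<open>h\<close>, so one
    bound on \<open>\<tau>\<close> serves all levels.\<close>
  have sol: "\<exists>u \<xi>. \<xi> \<in> clarke_subdiff J (\<iota> u)
      \<and> (\<forall>w. c * inner (i u) (i w) + A u w + \<xi> (\<iota> w) = g w + inner h (i w))"
    if c: "c0 \<le> c" for c h and g :: "'v \<Rightarrow>\<^sub>L real"
  proof -
    let ?g = "g + (blinfun_inner_right h o\<^sub>L I)"
    have "0 \<le> (norm ?g)\<^sup>2 / \<alpha> + d" using \<alpha>_pos d_pos by (intro add_nonneg_nonneg divide_nonneg_pos) auto
    then obtain u \<xi> where \<xi>: "\<xi> \<in> clarke_subdiff J (\<iota> u)" and "residual c ?g u \<xi> = 0"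
      using solution_exists[OF dense coer[OF c]] unfolding E by metis
    then have "residual c ?g u \<xi> w = 0" for w by simp
    then have "c * inner (i u) (i w) + A u w + \<xi> (\<iota> w) = g w + inner h (i w)" for w
      unfolding residual_apply I E by (simp add: blinfun.add_left I algebra_simps)
    with \<xi> show ?thesis by blast
  qed

  \<comment> \<open>Recursion over the time levels\<close>
  have scheme: "\<exists>u :: nat \<Rightarrow> 'v. \<exists>\<xi> :: nat \<Rightarrow> ('u \<Rightarrow>\<^sub>L real). u 0 = p \<and>
      (\<forall>w. (1 / \<tau>) * inner (i (u 1 - u 0)) (i w) + blinfun_apply (A (u 1)) w + blinfun_apply (\<xi> 1) (\<iota> w) = blinfun_apply (F 1) w) \<and>
      \<xi> 1 \<in> clarke_subdiff J (\<iota> (u 1)) \<and>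
      (\<forall>n\<in>{2..N}.
        (\<forall>w. (1 / \<tau>) * inner (i ((3/2) *\<^sub>R u n - 2 *\<^sub>R u (n - 1) + (1/2) *\<^sub>R u (n - 2))) (i w)
              + blinfun_apply (A (u n)) w + blinfun_apply (\<xi> n) (\<iota> w) = blinfun_apply (F n) w) \<and> \<xi> n \<in> clarke_subdiff J (\<iota> (u n)))"
    if \<tau>: "0 < \<tau>" "\<tau> < 1 / c0" for \<tau> p N and F :: "nat \<Rightarrow> 'v \<Rightarrow>\<^sub>L real"
  proof -
    \<comment> \<open>The coefficients of the unknown in the first step and in the later two-step
      formula.\<close>
    have c: "c0 \<le> 1 / \<tau>" "c0 \<le> 3 / (2 * \<tau>)" using \<tau> c0 by (simp_all add: field_simps)
    define first where "first x y \<xi> \<longleftrightarrow> \<xi> \<in> clarke_subdiff J (\<iota> y) \<and>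
        (\<forall>w. (1 / \<tau>) * inner (i (y - x)) (i w) + A y w + blinfun_apply \<xi> (\<iota> w) = F 1 w)" for x y \<xi>
    define step where "step n x y z \<xi> \<longleftrightarrow> \<xi> \<in> clarke_subdiff J (\<iota> z) \<and>
        (\<forall>w. (1 / \<tau>) * inner (i ((3/2) *\<^sub>R z - 2 *\<^sub>R y + (1/2) *\<^sub>R x)) (i w) + A z w + blinfun_apply \<xi> (\<iota> w) = F n w)"
      for n x y z \<xi>
    have ex_first: "\<exists>y \<xi>. first x y \<xi>" for x
      using sol[OF c(1), of "F 1" "(1 / \<tau>) *\<^sub>R i x"]
      unfolding first_def by (simp add: i.diff inner_diff_left algebra_simps)
    have ex_step: "\<exists>z \<xi>. step n x y z \<xi>" for n x y
      using sol[OF c(2), of "F n" "(1 / \<tau>) *\<^sub>R i (2 *\<^sub>R y - (1/2) *\<^sub>R x)"]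
      unfolding step_def by (simp add: i.diff i.add i.scaleR inner_diff_left inner_add_left algebra_simps)
    \<comment> \<open>The state \<open>s n\<close> is the triple of \<open>u n\<close>,
      \<open>u (n + 1)\<close> and \<open>\<xi> (n + 1)\<close>, which makes the two-step recursion
      a one-step one; passing to \<open>s (Suc n)\<close> solves level \<open>n + 2\<close>.\<close>
    have "\<exists>s. \<forall>n. (n = 0 \<longrightarrow> fst (s n) = p \<and> first p (fst (snd (s n))) (snd (snd (s n)))) \<and>
        (fst (s (Suc n)) = fst (snd (s n)) \<and>
         step (n + 2) (fst (s n)) (fst (snd (s n))) (fst (snd (s (Suc n)))) (snd (snd (s (Suc n)))))"
      by (rule dependent_nat_choice) (use ex_first ex_step in auto)
    then obtain s where s0: "fst (s 0) = p" "first p (fst (snd (s 0))) (snd (snd (s 0)))"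
      and s: "\<And>n. fst (s (Suc n)) = fst (snd (s n))"
        "\<And>n. step (n + 2) (fst (s n)) (fst (snd (s n))) (fst (snd (s (Suc n)))) (snd (snd (s (Suc n))))"
      by blast
    define u where "u n = fst (s n)" for n
    \<comment> \<open>The subgradient of level \<open>n\<close> is stored in state
      \<open>n - 1\<close>; the value at \<open>0\<close> is a mere default.\<close>
    define \<xi> where "\<xi> n = snd (snd (s (n - 1)))" for n
    have "first (u 0) (u 1) (\<xi> 1)" using s0 s(1)[of 0] by (simp add: u_def \<xi>_def)
    moreover have "step n (u (n - 2)) (u (n - 1)) (u n) (\<xi> n)" if "n \<in> {2..N}" for n
    proof -
      have "2 \<le> n" using that by simp
      then obtain m where n: "n = Suc (Suc m)" unfolding add_2_eq_Suc[symmetric] by (rule le_Suc_ex[THEN exE])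
      have "u (n - 2) = fst (s m)" "u (n - 1) = fst (snd (s m))" "u n = fst (snd (s (Suc m)))"
        "\<xi> n = snd (snd (s (Suc m)))"
        by (simp_all add: n u_def \<xi>_def s(1))
      then show ?thesis using s(2)[of m] by (simp only: n add_2_eq_Suc')
    qed
    ultimately show ?thesis
      using s0(1) unfolding first_def step_def by (intro exI[of _ u] exI[of _ \<xi>]) (auto simp: u_def)
  qed
  show ?thesis
    unfolding Let_def
    by (intro exI[of _ "1 / c0"] conjI allI impI scheme) (use c0 T_pos in auto)
qed

end
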